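(* Let $n$ be a sufficiently large integer and let $q = q(n)$ be a positive integer. Then, for the $(q:1)$ Waiter-Client game on $E(K_n)$, the following hold: (i) If $q \geq 1.1 n$, then Client has a strategy to keep his graph acyclic throughout the game. (ii) There exists a positive constant $c$ (not depending on $n$) such that, if $q \leq c n$, then Waiter has a strategy to ensure that, at the end of the game, Client's graph is pancyclic.
   Context: The $(q:1)$ Waiter-Client game on $E(K_n)$ (for a positive integer $q$) is the following two-player perfect information game. In each round, Waiter offers Client exactly $q+1$ edges of the complete graph $K_n$ which have not been claimed before; Client chooses one of these edges, which he keeps, and the remaining $q$ edges are claimed by Waiter. If fewer than $q+1$ unclaimed edges remain, all of them are claimed by Waiter. The game ends when all edges of $K_n$ have been claimed. Client's graph is the graph with vertex set $V(K_n)$ whose edges are all the edges claimed by Client. A graph on $n$ vertices is pancyclic if it contains a cycle of length $k$ for every $3 \leq k \leq n$. *)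

theory Defs
  imports Complex_Main
begin

section \<open>Simple graphs\<close>

text \<open>A graph is a pair of a vertex set and a set of two-element sets of vertices.\<close>

type_synonym 'a edge = "'a set"
type_synonym 'a graph = "'a set \<times> 'a edge set"

definition complete_edges :: "nat \<Rightarrow> nat edge set" where
  "complete_edges n = {e. e \<subseteq> {..<n} \<and> card e = 2}"

text \<open>A cycle is given by the cyclic sequence of its pairwise distinct vertices; the first
  vertex is not repeated at the end, so the length of the list is the length of the cycle.\<close>

definition is_cycle :: "'a graph \<Rightarrow> 'a list \<Rightarrow> bool" where
  "is_cycle G vs \<longleftrightarrow> 3 \<le> length vs \<and> distinct vs \<and> set vs \<subseteq> fst G \<and>
     (\<forall>i < length vs. {vs ! i, vs ! (Suc i mod length vs)} \<in> snd G)"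

definition acyclic_graph :: "'a graph \<Rightarrow> bool" where
  "acyclic_graph G \<longleftrightarrow> (\<nexists>vs. is_cycle G vs)"

definition pancyclic :: "'a graph \<Rightarrow> bool" where
  "pancyclic G \<longleftrightarrow> (\<forall>k. 3 \<le> k \<and> k \<le> card (fst G) \<longrightarrow> (\<exists>vs. is_cycle G vs \<and> length vs = k))"


section \<open>The Waiter-Client game on the edges of the complete graph\<close>

text \<open>A history lists the rounds played so far, oldest first. A round consists of the set of
  edges offered by Waiter and the offered edge kept by Client; the other offered edges go to
  Waiter. The edges left over when no further full offer is possible also go to Waiter; this
  is not recorded as a round since it does not change Client's graph.\<close>

type_synonym history = "(nat edge set \<times> nat edge) list"

definition unclaimed :: "nat \<Rightarrow> history \<Rightarrow> nat edge set" where
  "unclaimed n h = complete_edges n - \<Union> (fst ` set h)"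

definition client_graph :: "nat \<Rightarrow> history \<Rightarrow> nat graph" where
  "client_graph n h = ({..<n}, snd ` set h)"

definition legal_offer :: "nat \<Rightarrow> nat \<Rightarrow> history \<Rightarrow> nat edge set \<Rightarrow> bool" where
  "legal_offer n q h F \<longleftrightarrow> F \<subseteq> unclaimed n h \<and> card F = q + 1"

definition legal_play :: "nat \<Rightarrow> nat \<Rightarrow> history \<Rightarrow> bool" where
  "legal_play n q h \<longleftrightarrow>
     (\<forall>i < length h. legal_offer n q (take i h) (fst (h ! i)) \<and> snd (h ! i) \<in> fst (h ! i))"

definition game_over :: "nat \<Rightarrow> nat \<Rightarrow> history \<Rightarrow> bool" where
  "game_over n q h \<longleftrightarrow> card (unclaimed n h) < q + 1"

type_synonym waiter_strategy = "history \<Rightarrow> nat edge set"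
type_synonym client_strategy = "history \<Rightarrow> nat edge set \<Rightarrow> nat edge"

definition valid_waiter_strategy :: "nat \<Rightarrow> nat \<Rightarrow> waiter_strategy \<Rightarrow> bool" where
  "valid_waiter_strategy n q \<sigma> \<longleftrightarrow>
     (\<forall>h. legal_play n q h \<and> \<not> game_over n q h \<longrightarrow> legal_offer n q h (\<sigma> h))"

definition valid_client_strategy :: "nat \<Rightarrow> nat \<Rightarrow> client_strategy \<Rightarrow> bool" where
  "valid_client_strategy n q \<tau> \<longleftrightarrow>
     (\<forall>h F. legal_play n q h \<and> legal_offer n q h F \<longrightarrow> \<tau> h F \<in> F)"

definition follows_waiter :: "waiter_strategy \<Rightarrow> history \<Rightarrow> bool" where
  "follows_waiter \<sigma> h \<longleftrightarrow> (\<forall>i < length h. fst (h ! i) = \<sigma> (take i h))"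

definition follows_client :: "client_strategy \<Rightarrow> history \<Rightarrow> bool" where
  "follows_client \<tau> h \<longleftrightarrow> (\<forall>i < length h. snd (h ! i) = \<tau> (take i h) (fst (h ! i)))"

text \<open>Legal plays need not be finished, so the next definition asks for the property after
  every round.\<close>

definition client_can_maintain :: "nat \<Rightarrow> nat \<Rightarrow> (nat graph \<Rightarrow> bool) \<Rightarrow> bool" where
  "client_can_maintain n q P \<longleftrightarrow>
     (\<exists>\<tau>. valid_client_strategy n q \<tau> \<and>
       (\<forall>h. legal_play n q h \<and> follows_client \<tau> h \<longrightarrow> P (client_graph n h)))"

definition waiter_can_force :: "nat \<Rightarrow> nat \<Rightarrow> (nat graph \<Rightarrow> bool) \<Rightarrow> bool" where
  "waiter_can_force n q P \<longleftrightarrow>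
     (\<exists>\<sigma>. valid_waiter_strategy n q \<sigma> \<and>
       (\<forall>h. legal_play n q h \<and> follows_waiter \<sigma> h \<and> game_over n q h \<longrightarrow> P (client_graph n h)))"

end

theory Submission
  imports Defs
begin

text \<open>
  Part (i): if Client picks uniformly at random, a cycle with no edge lost to Waiter and \<open>j\<close> edges
  still missing has weight \<open>(q+1)\<^sup>-\<^sup>j\<close>, and the expected total weight does not increase in a round. So
  Client can always choose an edge that does not increase it. Initially the weight of all cycles is
  at most \<open>\<Sum>k\<ge>3. x\<^sup>k / (2k)\<close> with \<open>x = n / (q+1) \<le> 10/11\<close>, which is less than 1, while a finished cycle
  has weight 1.

  Part (ii): let \<open>Q\<close> be a small constant proportion of the vertices. Waiter first forces all cycles of length
  at most \<open>|Q|\<close> outside \<open>Q\<close>. He then hits every complete bipartite graph between large sets, always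
  offering edges that lie in a constant proportion of the ones not yet hit. Now all small sets
  avoiding a small exceptional set \<open>X\<close> expand into \<open>Q\<close>; disjoint stars centred at \<open>X\<close> repair this, and every
  small set expands into \<open>Q\<close>. Posa's rotation argument provides quadratically many boosters, more than all
  edges offered so far, so Waiter can close a longest path again and again until there is a Hamilton
  cycle of \<open>Q\<close>. The remaining vertices are inserted one at a time, each at the cost of one booster,
  which yields all lengths from \<open>|Q|\<close> to \<open>n\<close>.
\<close>

section \<open>Plays\<close>

text \<open>In (ii) all stages together last O(n) rounds, so for q <= c n only O(c n^2) edges are
  ever offered. The number of boosters is at least a constant times n^2, with a constant independent
  of c, so a small c suffices. Hitting all pairs of large sets is affordable because there are at
  most 2^n targets and every round removes a fixed proportion of those left. Hitting controls sets
  of linear size only and says nothing about, for example, a single vertex that is still isolated in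
  Client's graph. The stars that repair this need edges which hitting has not consumed. For this
  reason Q is split into \<open>Q1\<close> and \<open>Q2\<close>, and only pairs between
  \<open>Q1\<close> and its complement are hit: a large set has many vertices in \<open>Q1\<close>,
  and then sees \<open>Q2\<close>, or many outside, and then sees \<open>Q1\<close>. The short
  cycles stay away from Q for the same reason. Expansion counts neighbours in Q only, so that it is
  not lost when the vertex set under consideration grows.\<close>

lemma legal_play_snoc:
  "legal_play n q (h @ [(F, e)]) \<longleftrightarrow> legal_play n q h \<and> legal_offer n q h F \<and> e \<in> F"
proof
  assume *: "legal_play n q (h @ [(F, e)])"
  have "legal_offer n q (take i h) (fst (h ! i)) \<and> snd (h ! i) \<in> fst (h ! i)" if "i < length h" for i
    using *[unfolded legal_play_def, rule_format, of i] that by (simp add: nth_append)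
  moreover have "legal_offer n q h F \<and> e \<in> F"
    using *[unfolded legal_play_def, rule_format, of "length h"] by simp
  ultimately show "legal_play n q h \<and> legal_offer n q h F \<and> e \<in> F"
    by (auto simp: legal_play_def)
next
  assume "legal_play n q h \<and> legal_offer n q h F \<and> e \<in> F"
  then show "legal_play n q (h @ [(F, e)])"
    by (auto simp: legal_play_def nth_append less_Suc_eq)
qed

lemma follows_client_snoc:
  "follows_client \<tau> (h @ [(F, e)]) \<longleftrightarrow> follows_client \<tau> h \<and> e = \<tau> h F"
  unfolding follows_client_def
  by (auto simp: nth_append less_Suc_eq all_conj_distrib)

lemma follows_waiter_snoc:
  "follows_waiter \<sigma> (h @ [(F, e)]) \<longleftrightarrow> follows_waiter \<sigma> h \<and> F = \<sigma> h"
  unfolding follows_waiter_def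
  by (auto simp: nth_append less_Suc_eq all_conj_distrib)

abbreviation client_edges :: "history \<Rightarrow> nat edge set" where
  "client_edges h \<equiv> snd ` set h"

lemma unclaimed_snoc: "unclaimed n (h @ [(F, e)]) = unclaimed n h - F"
  by (auto simp: unclaimed_def)

lemma unclaimed_Nil: "unclaimed n [] = complete_edges n"
  by (auto simp: unclaimed_def)

lemma finite_complete_edges: "finite (complete_edges n)"
  by (rule finite_subset[of _ "Pow {..<n}"]) (auto simp: complete_edges_def)

lemma finite_unclaimed: "finite (unclaimed n h)"
  unfolding unclaimed_def using finite_complete_edges by blast

lemma client_edges_claimed:
  "legal_play n q h \<Longrightarrow> client_edges h \<inter> unclaimed n h = {}"
proof (induction h rule: rev_induct)
  case (snoc x h)
  then show ?case by (cases x) (auto simp: legal_play_snoc unclaimed_snoc)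
qed simp

section \<open>Edges of paths and cycles\<close>

fun adjs :: "'a list \<Rightarrow> 'a set set" where
  "adjs [] = {}"
| "adjs [x] = {}"
| "adjs (x # y # zs) = insert {x, y} (adjs (y # zs))"

lemma adjs_Cons: "xs \<noteq> [] \<Longrightarrow> adjs (x # xs) = insert {x, hd xs} (adjs xs)"
  by (cases xs) auto

lemma adjs_append:
  "xs \<noteq> [] \<Longrightarrow> ys \<noteq> [] \<Longrightarrow> adjs (xs @ ys) = insert {last xs, hd ys} (adjs xs \<union> adjs ys)"
  by (induction xs rule: adjs.induct) (auto simp: adjs_Cons)

lemma adjs_rev [simp]: "adjs (rev xs) = adjs xs"
proof (induction xs)
  case (Cons x xs)
  then show ?case
    by (cases "xs = []") (auto simp: adjs_append adjs_Cons last_rev insert_commute)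
qed simp

lemma adjs_subset: "e \<in> adjs xs \<Longrightarrow> e \<subseteq> set xs"
  by (induction xs rule: adjs.induct) auto

lemma finite_adjs: "finite (adjs xs)"
  by (induction xs rule: adjs.induct) auto

lemma adjs_eq_nth: "adjs xs = {{xs ! i, xs ! Suc i} |i. Suc i < length xs}"
proof (induction xs rule: adjs.induct)
  case (3 x y zs)
  have "{{(x # y # zs) ! i, (x # y # zs) ! Suc i} |i. Suc i < length (x # y # zs)} =
     insert {x, y} {{(y # zs) ! i, (y # zs) ! Suc i} |i. Suc i < length (y # zs)}" (is "?L = ?R")
  proof
    show "?L \<subseteq> ?R"
    proof
      fix e assume "e \<in> ?L"
      then obtain i where i: "e = {(x # y # zs) ! i, (x # y # zs) ! Suc i}" "Suc i < length (x # y # zs)"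
        by auto
      show "e \<in> ?R" using i by (cases i) auto
    qed
    show "?R \<subseteq> ?L"
    proof
      fix e assume "e \<in> ?R"
      then consider "e = {x, y}" | i where "e = {(y # zs) ! i, (y # zs) ! Suc i}" "Suc i < length (y # zs)"
        by auto
      then show "e \<in> ?L"
      proof cases
        case 1 then show ?thesis by (intro CollectI exI[of _ 0]) simp
      next
        case (2 i) then show ?thesis by (intro CollectI exI[of _ "Suc i"]) simp
      qed
    qed
  qed
  then show ?case using 3 by simp
qed auto

lemma card_adjs: "distinct xs \<Longrightarrow> card (adjs xs) = length xs - 1"
proof (induction xs rule: adjs.induct)
  case (3 x y zs)
  have "{x, y} \<notin> adjs (y # zs)"
    using adjs_subset[of "{x, y}" "y # zs"] 3(2) by auto
  then show ?case using 3 by (simp add: finite_adjs)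
qed auto

definition cyc_edges :: "'a list \<Rightarrow> 'a set set" where
  "cyc_edges xs = insert {last xs, hd xs} (adjs xs)"

lemma cyc_edges_eq_nth:
  assumes "xs \<noteq> []"
  shows "cyc_edges xs = {{xs ! i, xs ! (Suc i mod length xs)} |i. i < length xs}"
proof -
  have "i < length xs \<longleftrightarrow> Suc i < length xs \<or> i = length xs - 1" for i
    using assms by (cases xs) auto
  then have "{{xs ! i, xs ! (Suc i mod length xs)} |i. i < length xs} =
      {{xs ! i, xs ! (Suc i mod length xs)} |i. Suc i < length xs} \<union>
      {{xs ! (length xs - 1), xs ! (Suc (length xs - 1) mod length xs)}}"
    by blast
  also have "{{xs ! i, xs ! (Suc i mod length xs)} |i. Suc i < length xs} = adjs xs"
    unfolding adjs_eq_nth by (metis (no_types, lifting) mod_less)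
  also have "{xs ! (length xs - 1), xs ! (Suc (length xs - 1) mod length xs)} = {last xs, hd xs}"
    using assms by (simp add: last_conv_nth hd_conv_nth)
  finally show ?thesis by (auto simp: cyc_edges_def)
qed

lemma is_cycle_iff:
  "is_cycle G xs \<longleftrightarrow> 3 \<le> length xs \<and> distinct xs \<and> set xs \<subseteq> fst G \<and> cyc_edges xs \<subseteq> snd G"
proof (cases "xs = []")
  case False
  show ?thesis unfolding is_cycle_def cyc_edges_eq_nth[OF False] by auto
qed (simp add: is_cycle_def)

text \<open>From length 3 on the closing edge differs from every path edge; for two vertices it
  would coincide with the only one.\<close>

lemma card_cyc_edges:
  assumes "distinct xs" "3 \<le> length xs"
  shows "card (cyc_edges xs) = length xs"
proof -
  obtain x y zs where xs: "xs = x # y # zs" "zs \<noteq> []"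
    using assms(2) by (cases xs rule: adjs.cases; force)
  have "{last xs, hd xs} \<noteq> {x, y}" using xs assms by (auto simp: doubleton_eq_iff)
  moreover have "{last xs, hd xs} \<notin> adjs (y # zs)"
    using adjs_subset[of "{last xs, hd xs}" "y # zs"] xs assms by auto
  ultimately have "{last xs, hd xs} \<notin> adjs xs" using xs by simp
  then show ?thesis using card_adjs[OF assms(1)] assms(2) by (simp add: cyc_edges_def finite_adjs)
qed

lemma finite_cyc_edges: "finite (cyc_edges xs)"
  by (simp add: cyc_edges_def finite_adjs)

lemma cyc_edges_rev: "xs \<noteq> [] \<Longrightarrow> cyc_edges (rev xs) = cyc_edges xs"
  by (simp add: cyc_edges_def last_rev hd_rev insert_commute)

lemma cyc_edges_rotate1: "cyc_edges (rotate1 xs) = cyc_edges xs"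
proof (cases xs)
  case (Cons x ys)
  then show ?thesis
    by (cases "ys = []") (auto simp: cyc_edges_def adjs_append adjs_Cons)
qed simp

lemma cyc_edges_rotate: "cyc_edges (rotate i xs) = cyc_edges xs"
  by (induction i) (simp_all add: cyc_edges_rotate1)

section \<open>Counting the lists that represent one cycle\<close>

lemma inj_on_rotate:
  assumes "distinct xs"
  shows "inj_on (\<lambda>i. rotate i xs) {..<length xs}"
proof (rule inj_onI)
  fix i j assume ij: "i \<in> {..<length xs}" "j \<in> {..<length xs}" "rotate i xs = rotate j xs"
  then have "xs ! i = xs ! j"
    using hd_rotate_conv_nth[of xs i] hd_rotate_conv_nth[of xs j] by fastforce
  then show "i = j" using assms ij by (simp add: nth_eq_iff_index_eq)
qed

text \<open>Comparing the entries at position \<open>t\<close> gives i + j + 2t + 1 = 0 modulo the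
  length. Subtracting the cases t = 0 and t = 1 shows that the length divides 2.\<close>

lemma rotate_rev_neq:
  assumes "distinct xs" "3 \<le> length xs"
  shows "rotate i (rev xs) \<noteq> rotate j xs"
proof
  assume eq: "rotate i (rev xs) = rotate j xs"
  define k where "k = length xs"
  have dv: "k dvd i + j + (t + t) + 1" if t: "t < k" for t
  proof -
    define a where "a = (i + t) mod k"
    define b where "b = (j + t) mod k"
    have ab: "a < k" "b < k"
      unfolding a_def b_def using t by (auto intro: mod_less_divisor)
    have "rotate i (rev xs) ! t = xs ! (k - Suc a)"
      using t ab by (simp add: nth_rotate rev_nth k_def a_def)
    moreover have "rotate j xs ! t = xs ! b"
      using t by (simp add: nth_rotate k_def b_def)
    ultimately have "xs ! (k - Suc a) = xs ! b" using eq by simp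
    then have "k - Suc a = b"
      using assms(1) ab by (subst (asm) nth_eq_iff_index_eq) (auto simp: k_def)
    then have "a + b + 1 = k" using ab by linarith
    then have "(a + (b + 1)) mod k = 0" by simp
    then have "(i + t + ((j + t) + 1)) mod k = 0"
      unfolding a_def b_def by (metis mod_add_left_eq mod_add_eq)
    then show ?thesis by (simp add: dvd_eq_mod_eq_0 ac_simps)
  qed
  have "k dvd (i + j + (1 + 1) + 1) - (i + j + (0 + 0) + 1)"
    using dv[of 0] dv[of 1] assms(2) unfolding k_def by (intro dvd_diff_nat) linarith+
  then have "k dvd 2" by simp
  then show False using assms(2) by (auto simp: k_def dest: dvd_imp_le)
qed

definition dihedral_orbit :: "'a list \<Rightarrow> 'a list set" where
  "dihedral_orbit xs = (\<lambda>i. rotate i xs) ` {..<length xs} \<union> (\<lambda>i. rotate i (rev xs)) ` {..<length xs}"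

lemma card_dihedral_orbit:
  assumes "distinct xs" "3 \<le> length xs"
  shows "card (dihedral_orbit xs) = 2 * length xs"
proof -
  have "card ((\<lambda>i. rotate i xs) ` {..<length xs}) = length xs"
    using inj_on_rotate[OF assms(1)] by (simp add: card_image)
  moreover have "card ((\<lambda>i. rotate i (rev xs)) ` {..<length xs}) = length xs"
    using inj_on_rotate[of "rev xs"] assms(1) by (simp add: card_image)
  moreover have "(\<lambda>i. rotate i xs) ` {..<length xs} \<inter> (\<lambda>i. rotate i (rev xs)) ` {..<length xs} = {}"
    
  proof (rule ccontr)
    assume "\<not> ?thesis"
    then obtain i j where "rotate j xs = rotate i (rev xs)" by auto
    from this[symmetric] show False using rotate_rev_neq[OF assms] by blast
  qed
  ultimately show ?thesis unfolding dihedral_orbit_def by (subst card_Un_disjoint) auto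
qed

lemma dihedral_orbitD:
  assumes "ys \<in> dihedral_orbit xs" "xs \<noteq> []"
  shows "length ys = length xs" "distinct ys = distinct xs" "set ys = set xs" "cyc_edges ys = cyc_edges xs"
  using assms by (auto simp: dihedral_orbit_def cyc_edges_rotate cyc_edges_rev)

section \<open>Client keeps his graph acyclic\<close>

text \<open>An index family is used instead of a set of edge sets, so that different lists with the
  same edges all count. \<open>U\<close> holds the unclaimed edges and \<open>C\<close> Client's
  edges, so the guard discards a target as soon as Waiter owns one of its edges.\<close>

definition potential :: "nat \<Rightarrow> 'i set \<Rightarrow> ('i \<Rightarrow> real) \<Rightarrow> ('i \<Rightarrow> 'e set) \<Rightarrow> 'e set \<Rightarrow> 'e set \<Rightarrow> real" where
  "potential q I w a U C =
     (\<Sum>i\<in>I. if a i \<subseteq> U \<union> C then w i / (real q + 1) ^ card (a i - C) else 0)"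

text \<open>Sum over the \<open>q + 1\<close> possible answers. A target that misses the offer keeps
  its value under each answer; one with exactly one offered edge survives a single answer, with its
  value multiplied by \<open>q + 1\<close>; one with two or more offered edges is lost under every
  answer. So the average does not exceed the old potential.\<close>

lemma potential_averaging:
  assumes "finite I" "\<And>i. i \<in> I \<Longrightarrow> w i \<ge> 0" "\<And>i. i \<in> I \<Longrightarrow> finite (a i)"
    and "U \<inter> C = {}" "F \<subseteq> U" "card F = q + 1"
  shows "\<exists>e\<in>F. potential q I w a (U - F) (insert e C) \<le> potential q I w a U C"
proof (rule ccontr)
  assume "\<not> ?thesis"
  then have less: "potential q I w a U C < potential q I w a (U - F) (insert e C)" if "e \<in> F" for e
    using that by force
  have finF: "finite F" using assms(6) card.infinite by fastforce
  define t where "t = (\<lambda>i U C. if a i \<subseteq> U \<union> C then w i / (real q + 1) ^ card (a i - C) else 0)"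
  have t_sum: "(\<Sum>e\<in>F. t i (U - F) (insert e C)) \<le> (real q + 1) * t i U C" if i: "i \<in> I" for i
  proof -
    have nonneg: "t i U' C' \<ge> 0" for U' C' using assms(2)[OF i] by (simp add: t_def)
    consider "\<not> a i \<subseteq> U \<union> C" | "a i \<subseteq> U \<union> C" "a i \<inter> F = {}"
      | e where "a i \<subseteq> U \<union> C" "a i \<inter> F = {e}"
      | e f where "e \<in> a i \<inter> F" "f \<in> a i \<inter> F" "e \<noteq> f"
      by blast
    then show ?thesis
    proof cases
      case 1
      then have "t i (U - F) (insert e C) = 0" if "e \<in> F" for e
        using that assms(5) by (auto simp: t_def)
      then show ?thesis using nonneg by simp
    next
      case 2
      have "t i (U - F) (insert e C) = t i U C" if "e \<in> F" for e
      proof -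
        have "a i - insert e C = a i - C" "a i \<subseteq> U - F \<union> insert e C" using that 2 by auto
        then show ?thesis using 2 by (simp add: t_def)
      qed
      then show ?thesis using assms(6) by (simp add: add.commute)
    next
      case (3 e)
      have e: "e \<in> F" "e \<notin> C" "e \<in> a i" using 3 assms by blast+
      have "card (a i - C) = Suc (card (a i - insert e C))"
        using e assms(3)[OF i] card.remove[of "a i - C" e] by (simp flip: Diff_insert)
      moreover have "a i \<subseteq> U - F \<union> insert e C" using 3 by blast
      ultimately have "t i (U - F) (insert e C) = (real q + 1) * t i U C"
        using 3 by (simp add: t_def)
      moreover have "t i (U - F) (insert f C) = 0" if "f \<in> F - {e}" for f
        using that e assms(4,5) by (auto simp: t_def)
      ultimately show ?thesis using e finF by (simp add: sum.remove)
    next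
      case (4 e f)
      have "t i (U - F) (insert g C) = 0" if "g \<in> F" for g
      proof -
        have "\<not> a i \<subseteq> U - F \<union> insert g C" using 4 assms(4,5) by blast
        then show ?thesis by (simp add: t_def)
      qed
      then show ?thesis using nonneg by simp
    qed
  qed
  have "F \<noteq> {}" using assms(6) by auto
  then have "(\<Sum>e\<in>F. potential q I w a U C) < (\<Sum>e\<in>F. potential q I w a (U - F) (insert e C))"
    using finF less by (intro sum_strict_mono) auto
  also have "\<dots> = (\<Sum>i\<in>I. \<Sum>e\<in>F. t i (U - F) (insert e C))"
    unfolding potential_def t_def by (rule sum.swap)
  also have "\<dots> \<le> (\<Sum>i\<in>I. (real q + 1) * t i U C)" by (intro sum_mono t_sum)
  also have "\<dots> = (\<Sum>e\<in>F. potential q I w a U C)"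
    using assms(6) by (simp add: potential_def t_def sum_distrib_left add.commute)
  finally show False by simp
qed

text \<open>An Erdos-Selfridge type criterion: the potential stays below 1 along the play, and a
  completed target contributes its full weight \<open>w i\<close>, since no edge of it is missing.
  Hence the completed targets never reach total weight 1.\<close>

lemma client_avoids:
  assumes fin: "finite I" and w: "\<And>i. i \<in> I \<Longrightarrow> w i \<ge> 0" and fa: "\<And>i. i \<in> I \<Longrightarrow> finite (a i)"
    and start: "potential q I w a (complete_edges n) {} < 1"
    and P: "\<And>C. \<not> P ({..<n}, C) \<Longrightarrow> (\<Sum>i | i \<in> I \<and> a i \<subseteq> C. w i) \<ge> 1"
  shows "client_can_maintain n q P"
proof -
  let ?\<Phi> = "potential q I w a"
  define \<tau> where "\<tau> = (\<lambda>h F. SOME e. e \<in> F \<and>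
     ?\<Phi> (unclaimed n h - F) (insert e (client_edges h)) \<le> ?\<Phi> (unclaimed n h) (client_edges h))"
  have \<tau>: "\<tau> h F \<in> F \<and> ?\<Phi> (unclaimed n h - F) (insert (\<tau> h F) (client_edges h))
      \<le> ?\<Phi> (unclaimed n h) (client_edges h)"
    if "legal_play n q h" "legal_offer n q h F" for h F
  proof -
    have "\<exists>e\<in>F. ?\<Phi> (unclaimed n h - F) (insert e (client_edges h)) \<le> ?\<Phi> (unclaimed n h) (client_edges h)"
      by (rule potential_averaging[OF fin w fa])
        (use client_edges_claimed[OF that(1)] that(2) in \<open>auto simp: legal_offer_def\<close>)
    then have "\<exists>e. e \<in> F \<and> ?\<Phi> (unclaimed n h - F) (insert e (client_edges h))
        \<le> ?\<Phi> (unclaimed n h) (client_edges h)"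
      by (simp add: Bex_def)
    then show ?thesis unfolding \<tau>_def by (rule someI_ex)
  qed
  have less: "?\<Phi> (unclaimed n h) (client_edges h) < 1" if "legal_play n q h" "follows_client \<tau> h" for h
    using that
  proof (induction h rule: rev_induct)
    case Nil
    then show ?case using start by (simp add: unclaimed_Nil)
  next
    case (snoc x h)
    obtain F e where x: "x = (F, e)" by (cases x)
    have "?\<Phi> (unclaimed n (h @ [x])) (client_edges (h @ [x])) \<le> ?\<Phi> (unclaimed n h) (client_edges h)"
      using snoc.prems \<tau>[of h F] by (simp add: x unclaimed_snoc legal_play_snoc follows_client_snoc)
    then show ?case
      using snoc by (simp add: x legal_play_snoc follows_client_snoc)
  qed
  have "P (client_graph n h)" if h: "legal_play n q h" "follows_client \<tau> h" for h
  proof (rule ccontr)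
    let ?C = "client_edges h"
    assume "\<not> P (client_graph n h)"
    then have "1 \<le> (\<Sum>i | i \<in> I \<and> a i \<subseteq> ?C. w i)" by (intro P) (simp add: client_graph_def)
    also have "\<dots> = (\<Sum>i\<in>I. if a i \<subseteq> ?C then w i else 0)"
      using fin by (simp add: sum.inter_filter)
    also have "\<dots> \<le> ?\<Phi> (unclaimed n h) ?C"
      unfolding potential_def
    proof (rule sum_mono)
      fix i assume i: "i \<in> I"
      show "(if a i \<subseteq> ?C then w i else 0) \<le>
         (if a i \<subseteq> unclaimed n h \<union> ?C then w i / (real q + 1) ^ card (a i - ?C) else 0)"
      proof (cases "a i \<subseteq> ?C")
        case True
        then have "a i - ?C = {}" "a i \<subseteq> unclaimed n h \<union> ?C" by blast+
        moreover from this(1) have "card (a i - ?C) = 0" by (simp only: card.empty)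
        ultimately show ?thesis using True by (simp only: power_0 div_by_1 if_True)
      qed (use w[OF i] in simp)
    qed
    finally show False using less[OF h] by simp
  qed
  moreover have "valid_client_strategy n q \<tau>" unfolding valid_client_strategy_def using \<tau> by blast
  ultimately show ?thesis unfolding client_can_maintain_def by blast
qed

lemma sum_power_div_less_two:
  fixes x :: real
  assumes "0 \<le> x" "x \<le> 10 / 11"
  shows "(\<Sum>k=3..n. x ^ k / real k) < 2"
proof -
  let ?y = "10 / 11 :: real"
  \<comment> \<open>The factor 11 is 1 / (1 - 10/11). A geometric bound from index 3 or 4 on would
    exceed 2; starting at index 5 the total is about 1.79.\<close>
  have bound: "(\<Sum>k=5..n. ?y ^ k / real k) \<le> ?y ^ 5 * 11 / 5"
  proof -
    have "(\<Sum>k=5..n. ?y ^ k / real k) \<le> (\<Sum>k=5..n. ?y ^ k / 5)"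
      by (intro sum_mono divide_left_mono) auto
    also have "\<dots> = (\<Sum>k=5..n. ?y ^ k) / 5" by (rule sum_divide_distrib[symmetric])
    also have "(\<Sum>k=5..n. ?y ^ k) \<le> ?y ^ 5 * 11"
    proof (cases "5 \<le> n")
      case True
      then have "(\<Sum>k=5..n. ?y ^ k) = (?y ^ 5 - ?y ^ Suc n) * 11" by (subst sum_gp) simp
      then show ?thesis by simp
    qed simp
    finally show ?thesis by simp
  qed
  have "(\<Sum>k=3..n. x ^ k / real k) \<le> (\<Sum>k=3..n. ?y ^ k / real k)"
    using assms by (intro sum_mono divide_right_mono power_mono) auto
  also have "\<dots> \<le> (\<Sum>k\<in>{3,4} \<union> {5..n}. ?y ^ k / real k)"
    by (rule sum_mono2) auto
  also have "\<dots> = ?y ^ 3 / 3 + ?y ^ 4 / 4 + (\<Sum>k=5..n. ?y ^ k / real k)"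
    by (subst sum.union_disjoint) auto
  also have "\<dots> \<le> ?y ^ 3 / 3 + ?y ^ 4 / 4 + ?y ^ 5 * 11 / 5" using bound by simp
  also have "\<dots> < 2" by (simp add: power_divide)
  finally show ?thesis .
qed

text \<open>The potential runs over vertex lists. A cycle of length \<open>k\<close> is represented by the \<open>2k\<close> lists of an orbit,
  hence the weight \<open>1 / (2k)\<close> of each list.\<close>

lemma client_keeps_acyclic:
  assumes q: "real q \<ge> 1.1 * real n"
  shows "client_can_maintain n q acyclic_graph"
proof -
  let ?L = "\<lambda>k. {vs :: nat list. set vs \<subseteq> {..<n} \<and> length vs = k}"
  define I where "I = {vs :: nat list. distinct vs \<and> 3 \<le> length vs \<and> set vs \<subseteq> {..<n}}"
  define w where "w = (\<lambda>vs :: nat list. 1 / (2 * real (length vs)))"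
  have len: "length vs \<le> n" if "vs \<in> I" for vs
    using that card_mono[of "{..<n}" "set vs"] by (simp add: I_def distinct_card)
  have I_sub: "I \<subseteq> (\<Union>k\<in>{3..n}. ?L k)"
    using len by (force simp: I_def)
  have finL: "finite (?L k)" for k by (rule finite_lists_length_eq) simp
  have finI: "finite I" by (rule finite_subset[OF I_sub]) (use finL in blast)
  have "potential q I w cyc_edges (complete_edges n) {} \<le>
     (\<Sum>vs\<in>I. 1 / (2 * real (length vs)) / (real q + 1) ^ length vs)"
    unfolding potential_def by (rule sum_mono) (auto simp: I_def w_def card_cyc_edges)
  \<comment> \<open>Admitting lists with repetitions makes the count exactly n^k for each length
    k.\<close>
  also have "\<dots> \<le> (\<Sum>vs\<in>(\<Union>k\<in>{3..n}. ?L k). 1 / (2 * real (length vs)) / (real q + 1) ^ length vs)"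
    by (rule sum_mono2) (use I_sub finL in auto)
  also have "\<dots> = (\<Sum>k=3..n. \<Sum>vs\<in>?L k. 1 / (2 * real (length vs)) / (real q + 1) ^ length vs)"
    by (rule sum.UNION_disjoint) (use finL in auto)
  also have "\<dots> = (\<Sum>k=3..n. (real n / (real q + 1)) ^ k / real k) / 2"
    unfolding sum_divide_distrib by (rule sum.cong) (simp_all add: card_lists_length_eq power_divide)
  also have "(\<Sum>k=3..n. (real n / (real q + 1)) ^ k / real k) < 2"
    by (rule sum_power_div_less_two) (use q in \<open>auto simp: field_simps\<close>)
  finally have start: "potential q I w cyc_edges (complete_edges n) {} < 1" by simp
  show ?thesis
  proof (rule client_avoids[OF finI _ _ start])
    fix C assume "\<not> acyclic_graph ({..<n}, C)"
    then obtain vs where vs: "3 \<le> length vs" "distinct vs" "set vs \<subseteq> {..<n}" "cyc_edges vs \<subseteq> C"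
      by (auto simp: acyclic_graph_def is_cycle_iff)
    then have ne: "vs \<noteq> []" by auto
    have "1 = (\<Sum>us\<in>dihedral_orbit vs. w us)"
      using dihedral_orbitD(1)[OF _ ne] card_dihedral_orbit[OF vs(2,1)] ne by (simp add: w_def)
    also have "\<dots> \<le> (\<Sum>us | us \<in> I \<and> cyc_edges us \<subseteq> C. w us)"
    proof (rule sum_mono2)
      show "finite {us \<in> I. cyc_edges us \<subseteq> C}" using finI by simp
    qed (use vs dihedral_orbitD[OF _ ne] in \<open>auto simp: I_def w_def\<close>)
    finally show "1 \<le> (\<Sum>us | us \<in> I \<and> cyc_edges us \<subseteq> C. w us)" .
  qed (auto simp: w_def finite_cyc_edges)
qed

section \<open>Goals Waiter can force\<close>

text \<open>In \<open>force q r G U E\<close>, \<open>U\<close> is the set of edges Waiter may still offer and \<open>E\<close> is the set of Client's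
  edges; Waiter reaches \<open>G\<close> within \<open>r\<close> rounds.\<close>

fun force :: "nat \<Rightarrow> nat \<Rightarrow> ('e set \<Rightarrow> 'e set \<Rightarrow> bool) \<Rightarrow> 'e set \<Rightarrow> 'e set \<Rightarrow> bool" where
  "force q 0 G U E \<longleftrightarrow> G U E"
| "force q (Suc r) G U E \<longleftrightarrow>
     G U E \<or> (\<exists>F\<subseteq>U. card F = q + 1 \<and> (\<forall>e\<in>F. force q r G (U - F) (insert e E)))"

lemma force_now: "G U E \<Longrightarrow> force q r G U E"
  by (cases r) auto

lemma force_step:
  "F \<subseteq> U \<Longrightarrow> card F = q + 1 \<Longrightarrow> (\<And>e. e \<in> F \<Longrightarrow> force q r G (U - F) (insert e E)) \<Longrightarrow>
   force q (Suc r) G U E"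
  by auto

lemma force_SucE:
  assumes "force q (Suc r) G U E"
  obtains "G U E"
  | F where "F \<subseteq> U" "card F = q + 1" "\<And>e. e \<in> F \<Longrightarrow> force q r G (U - F) (insert e E)"
  using assms by auto

declare force.simps(2) [simp del]

lemma force_mono:
  assumes "force q r G U E" "\<And>U' E'. G U' E' \<Longrightarrow> G' U' E'"
  shows "force q r G' U E"
  using assms(1)
proof (induction r arbitrary: U E)
  case (Suc r)
  from Suc.prems show ?case
  proof (cases rule: force_SucE)
    case 1
    then show ?thesis using assms(2) force_now by metis
  next
    case (2 F)
    then show ?thesis using Suc.IH by (intro force_step) auto
  qed
qed (simp add: assms(2))

lemma force_bind:
  assumes "force q r G U E" "\<And>U' E'. G U' E' \<Longrightarrow> force q s G' U' E'"
  shows "force q (r + s) G' U E"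
  using assms(1)
proof (induction r arbitrary: U E)
  case (Suc r)
  \<comment> \<open>If \<open>G\<close> is reached early, the rounds left over from the first phase
    are added to the allowance of the second one.\<close>
  have add: "force q (t + s) G' U E" if "force q s G' U E" for t U E
    using that
  proof (induction s arbitrary: U E)
    case 0
    then show ?case by (simp add: force_now)
  next
    case (Suc s)
    from Suc.prems show ?case
    proof (cases rule: force_SucE)
      case (2 F)
      have "force q (Suc (t + s)) G' U E"
        using 2 Suc.IH by (intro force_step) auto
      then show ?thesis by simp
    qed (rule force_now)
  qed
  from Suc.prems show ?case
  proof (cases rule: force_SucE)
    case 1
    then show ?thesis using assms(2) add by blast
  next
    case (2 F)
    have "force q (Suc (r + s)) G' U E"
      using 2 Suc.IH by (intro force_step) auto
    then show ?thesis by simp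
  qed
qed (simp add: assms(2))

text \<open>A strategy on the board \<open>H\<close> can be played inside a larger board and leaves the rest untouched.\<close>

lemma force_frame:
  assumes "force q r G H E" "H \<subseteq> U" "finite U"
  shows "force q r (\<lambda>U' E'. U - H \<subseteq> U' \<and> U' \<subseteq> U \<and> E \<subseteq> E' \<and>
     card (U - U') \<le> r * (q + 1) \<and> G (U' \<inter> H) E') U E"
  using assms
proof (induction r arbitrary: U H E)
  case 0
  then show ?case by (simp add: Int_absorb1)
next
  case (Suc r)
  let ?G = "\<lambda>r H U E U' E'. U - H \<subseteq> U' \<and> U' \<subseteq> U \<and> E \<subseteq> E' \<and>
     card (U - U') \<le> r * (q + 1) \<and> G (U' \<inter> H) E'"
  show ?case
  proof (cases "G H E")
    case True
    then show ?thesis using Suc.prems by (intro force_now) (simp add: Int_absorb1)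
  next
    case False
    with Suc.prems(1) obtain F where F: "F \<subseteq> H" "card F = q + 1"
      and *: "\<And>e. e \<in> F \<Longrightarrow> force q r G (H - F) (insert e E)"
      by (metis force_SucE)
    show ?thesis
    proof (rule force_step[of F])
      fix e assume e: "e \<in> F"
      have "force q r (?G r (H - F) (U - F) (insert e E)) (U - F) (insert e E)"
        using Suc.prems by (intro Suc.IH * e) auto
      moreover have "?G (Suc r) H U E U' E'" if g: "?G r (H - F) (U - F) (insert e E) U' E'" for U' E'
      proof -
        have UF: "U - U' = (U - F - U') \<union> F" using g F(1) Suc.prems(2) by blast
        have "card (U - U') \<le> card (U - F - U') + card F"
          unfolding UF by (rule card_Un_le)
        moreover have "U' \<inter> (H - F) = U' \<inter> H" using g by blast
        ultimately show ?thesis using g F Suc.prems(2) by auto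
      qed
      ultimately show "force q r (?G (Suc r) H U E) (U - F) (insert e E)"
        by (rule force_mono)
    qed (use F Suc.prems in auto)
  qed
qed

lemma force_compose:
  assumes "force q r G H E" "H \<subseteq> U" "finite U"
    and "\<And>U' E'. U - H \<subseteq> U' \<Longrightarrow> U' \<subseteq> U \<Longrightarrow> E \<subseteq> E' \<Longrightarrow>
      card (U - U') \<le> r * (q + 1) \<Longrightarrow> G (U' \<inter> H) E' \<Longrightarrow> force q s G' U' E'"
  shows "force q (r + s) G' U E"
  by (rule force_bind[OF force_frame[OF assms(1-3)]]) (use assms(4) in blast)

text \<open>A position counts as winning if the goal can be forced in some number of rounds, and the
  strategy only preserves winning positions. This is enough: once no full offer is left,
  \<open>force\<close> can hold only because the goal itself holds.\<close>

lemma force_imp_waiter_can_force: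
  assumes start: "force q r (\<lambda>U E. P ({..<n}, E)) (complete_edges n) {}"
    and mono: "\<And>E E'. P ({..<n}, E) \<Longrightarrow> E \<subseteq> E' \<Longrightarrow> P ({..<n}, E')"
  shows "waiter_can_force n q P"
proof -
  let ?G = "\<lambda>U E. P ({..<n}, E)"
  let ?win = "\<lambda>U E. \<exists>r. force q r ?G U E"
  define \<sigma> where "\<sigma> = (\<lambda>h. SOME F. legal_offer n q h F \<and>
     (\<forall>e\<in>F. ?win (unclaimed n h) (client_edges h) \<longrightarrow> ?win (unclaimed n h - F) (insert e (client_edges h))))"
  have \<sigma>: "legal_offer n q h (\<sigma> h) \<and> (\<forall>e\<in>\<sigma> h. ?win (unclaimed n h) (client_edges h) \<longrightarrow>
       ?win (unclaimed n h - \<sigma> h) (insert e (client_edges h)))"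
    if "\<not> game_over n q h" for h
  proof -
    let ?U = "unclaimed n h" and ?E = "client_edges h"
    have "\<exists>F. legal_offer n q h F \<and> (\<forall>e\<in>F. ?win ?U ?E \<longrightarrow> ?win (?U - F) (insert e ?E))"
    proof (cases "?win ?U ?E \<and> \<not> ?G ?U ?E")
      case True
      then obtain r where r: "force q r ?G ?U ?E" by blast
      with True obtain r' where r': "force q (Suc r') ?G ?U ?E" by (cases r) auto
      from r' show ?thesis
      proof (cases rule: force_SucE)
        case 1
        then show ?thesis using True by blast
      next
        case (2 F)
        then show ?thesis unfolding legal_offer_def by blast
      qed
    next
      case False
      \<comment> \<open>The strategy must answer every history that is not over. Here the position
        is either not winning, where any full offer will do, or the goal already holds and
        monotonicity preserves it.\<close>
      have "q + 1 \<le> card ?U" using that by (simp add: game_over_def)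
      then obtain F where F: "F \<subseteq> ?U" "card F = q + 1" by (rule obtain_subset_with_card_n)
      have "?win (?U - F) (insert e ?E)" if "?win ?U ?E" for e
        using False that mono[of ?E "insert e ?E"] by (intro exI[of _ 0]) auto
      then show ?thesis using F unfolding legal_offer_def by blast
    qed
    then show ?thesis unfolding \<sigma>_def by (rule someI_ex)
  qed
  have win: "?win (unclaimed n h) (client_edges h)" if "legal_play n q h" "follows_waiter \<sigma> h" for h
    using that
  proof (induction h rule: rev_induct)
    case Nil
    then show ?case using start by (auto simp: unclaimed_Nil)
  next
    case (snoc x h)
    obtain F e where x: "x = (F, e)" by (cases x)
    have h: "legal_play n q h" "follows_waiter \<sigma> h" "legal_offer n q h F" "F = \<sigma> h" "e \<in> F"
      using snoc.prems by (auto simp: x legal_play_snoc follows_waiter_snoc)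
    have "\<not> game_over n q h"
      using h(3) card_mono[OF finite_unclaimed, of F n h] by (auto simp: legal_offer_def game_over_def)
    then have "?win (unclaimed n h - F) (insert e (client_edges h))"
      using \<sigma>[of h] snoc.IH[OF h(1,2)] h(4,5) by blast
    then show ?case by (simp add: x unclaimed_snoc)
  qed
  have "P (client_graph n h)" if h: "legal_play n q h" "follows_waiter \<sigma> h" "game_over n q h" for h
  proof -
    obtain r where "force q r ?G (unclaimed n h) (client_edges h)" using win[OF h(1,2)] by blast
    moreover have "card F \<noteq> q + 1" if "F \<subseteq> unclaimed n h" for F
      using h(3) card_mono[OF finite_unclaimed that] unfolding game_over_def by linarith
    ultimately have "P ({..<n}, client_edges h)"
      by (cases r) (simp, metis force_SucE)
    then show ?thesis by (simp add: client_graph_def)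
  qed
  moreover have "valid_waiter_strategy n q \<sigma>" unfolding valid_waiter_strategy_def using \<sigma> by blast
  ultimately show ?thesis unfolding waiter_can_force_def by blast
qed

text \<open>By averaging, at least \<open>q + 1\<close> edges lie in a proportion \<open>\<beta>\<close> of the sets not yet hit. When these are
  offered, the number of such sets drops by the factor \<open>1 - \<beta>\<close> whatever Client does.\<close>

lemma force_hitting:
  fixes \<F> :: "'e set set" and \<beta> :: real
  assumes "finite \<F>" "finite H" "\<And>A. A \<in> \<F> \<Longrightarrow> A \<subseteq> H"
    and "\<And>A. A \<in> \<F> \<Longrightarrow> real (card (A \<inter> U)) \<ge> real (q + 1) + \<beta> * card H + real (r * (q + 1))"
    and "0 \<le> \<beta>" "\<beta> \<le> 1" "U \<subseteq> H"
    and "real (card {A \<in> \<F>. A \<inter> E = {}}) * (1 - \<beta>) ^ r < 1"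
  shows "force q r (\<lambda>U' E'. \<forall>A\<in>\<F>. A \<inter> E' \<noteq> {}) U E"
  using assms(4,7,8)
proof (induction r arbitrary: U E)
  case 0
  then have "{A \<in> \<F>. A \<inter> E = {}} = {}" using assms(1) by simp
  then show ?case by auto
next
  case (Suc r)
  define X where "X = {A \<in> \<F>. A \<inter> E = {}}"
  have finX: "finite X" using assms(1) by (simp add: X_def)
  have finU: "finite U" using Suc.prems(2) assms(2) finite_subset by blast
  show ?case
  proof (cases "X = {}")
    case True
    then show ?thesis by (intro force_now) (auto simp: X_def)
  next
    case False
    then have Xpos: "card X > 0" using finX by (simp add: card_gt_0_iff)
    define d where "d = (\<lambda>e. card {A \<in> X. e \<in> A})"
    define V where "V = {e \<in> U. real (d e) \<ge> \<beta> * card X}"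
    have finV: "finite V" using finU by (simp add: V_def)
    \<comment> \<open>Double counting of pairs of a set not yet hit and an unclaimed edge in it.
      Edges outside \<open>V\<close> account for at most \<beta> \<open>* card H * card X\<close>
      pairs, so the remaining \<open>(q + 1) * card X\<close> pairs need at least
      \<open>q + 1\<close> edges in \<open>V\<close>.\<close>
    have "real (card X) * (real (q + 1) + \<beta> * card H) \<le> (\<Sum>A\<in>X. real (card (A \<inter> U)))"
    proof -
      have "real (q + 1) + \<beta> * card H \<le> real (card (A \<inter> U))" if "A \<in> X" for A
      proof -
        have "A \<in> \<F>" using that by (simp add: X_def)
        from Suc.prems(1)[OF this] show ?thesis
          using of_nat_0_le_iff[of "Suc r * (q + 1)", where 'a = real] by linarith
      qed
      then show ?thesis using sum_mono[of X "\<lambda>_. real (q + 1) + \<beta> * card H" "\<lambda>A. real (card (A \<inter> U))"] by simp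
    qed
    also have "\<dots> = (\<Sum>A\<in>X. \<Sum>e\<in>U. if e \<in> A then 1 else 0)"
      by (rule sum.cong) (use finU in \<open>simp_all add: sum.If_cases Int_commute Int_def\<close>)
    also have "\<dots> = (\<Sum>e\<in>U. real (d e))"
      unfolding d_def by (subst sum.swap) (use finX in \<open>simp add: sum.If_cases Int_def\<close>)
    also have "\<dots> \<le> (\<Sum>e\<in>U. (if e \<in> V then real (card X) else 0) + \<beta> * card X)"
    proof (rule sum_mono)
      fix e assume "e \<in> U"
      have "d e \<le> card X" unfolding d_def by (rule card_mono[OF finX]) auto
      then show "real (d e) \<le> (if e \<in> V then real (card X) else 0) + \<beta> * card X"
        using \<open>e \<in> U\<close> mult_nonneg_nonneg[OF assms(5), of "real (card X)"] by (auto simp: V_def)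
    qed
    also have "\<dots> = real (card V) * card X + card U * (\<beta> * card X)"
      using finU by (simp add: sum.distrib sum.If_cases V_def Int_def)
    also have "\<dots> \<le> real (card V) * card X + card H * (\<beta> * card X)"
      using card_mono[OF assms(2) Suc.prems(2)] assms(5) by (intro add_left_mono mult_right_mono) auto
    finally have "real (card X) * real (q + 1) \<le> real (card X) * real (card V)"
      by (simp add: algebra_simps)
    then have "q + 1 \<le> card V" using Xpos by simp
    then obtain F where F: "F \<subseteq> V" "card F = q + 1" using obtain_subset_with_card_n by metis
    then have FU: "F \<subseteq> U" by (auto simp: V_def)
    have finF: "finite F" using F finV finite_subset by blast
    show ?thesis
    proof (rule force_step[OF FU F(2)])
      fix e assume e: "e \<in> F"
      show "force q r (\<lambda>U' E'. \<forall>A\<in>\<F>. A \<inter> E' \<noteq> {}) (U - F) (insert e E)"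
      proof (rule Suc.IH)
        fix A assume A: "A \<in> \<F>"
        \<comment> \<open>A set loses at most \<open>q + 1\<close> edges per round; the summand with
          \<open>r * (q + 1)\<close> in the hypothesis is the reserve for this.\<close>
        have "card (A \<inter> U) \<le> card ((A \<inter> (U - F)) \<union> F)" using finU finF by (intro card_mono) auto
        also have "\<dots> \<le> card (A \<inter> (U - F)) + card F" by (rule card_Un_le)
        finally show "real (q + 1) + \<beta> * card H + real (r * (q + 1)) \<le> real (card (A \<inter> (U - F)))"
          using Suc.prems(1)[OF A] F(2) by (simp add: algebra_simps)
      next
        have "{A \<in> \<F>. A \<inter> insert e E = {}} = X - {A \<in> X. e \<in> A}" by (auto simp: X_def)
        moreover have "card (X - {A \<in> X. e \<in> A}) = card X - d e"
          unfolding d_def using finX by (intro card_Diff_subset) auto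
        moreover have "d e \<le> card X" unfolding d_def using finX by (intro card_mono) auto
        moreover have "real (d e) \<ge> \<beta> * card X" using e F by (auto simp: V_def)
        ultimately have "real (card {A \<in> \<F>. A \<inter> insert e E = {}}) \<le> card X * (1 - \<beta>)"
          by (simp add: of_nat_diff algebra_simps)
        then have "real (card {A \<in> \<F>. A \<inter> insert e E = {}}) * (1 - \<beta>) ^ r \<le> card X * (1 - \<beta>) * (1 - \<beta>) ^ r"
          using assms(6) by (intro mult_right_mono) auto
        also have "\<dots> < 1" using Suc.prems(3) by (simp add: X_def mult.assoc)
        finally show "real (card {A \<in> \<F>. A \<inter> insert e E = {}}) * (1 - \<beta>) ^ r < 1" .
      qed (use Suc.prems in auto)
    qed
  qed
qed

lemma force_one_of_each:
  assumes "distinct ks" "\<And>k. k \<in> set ks \<Longrightarrow> F k \<subseteq> U \<and> card (F k) = q + 1"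
    and "\<And>k l. k \<in> set ks \<Longrightarrow> l \<in> set ks \<Longrightarrow> k \<noteq> l \<Longrightarrow> F k \<inter> F l = {}" "finite U"
  shows "force q (length ks) (\<lambda>U' E'. \<forall>k\<in>set ks. F k \<inter> E' \<noteq> {}) U E"
  using assms
proof (induction ks arbitrary: U E)
  case (Cons k ks U E)
  have "force q (Suc (length ks)) (\<lambda>U' E'. \<forall>l\<in>set (k # ks). F l \<inter> E' \<noteq> {}) U E"
  proof (rule force_step)
    show "F k \<subseteq> U" "card (F k) = q + 1" using Cons.prems by auto
    fix e assume e: "e \<in> F k"
    have "force q (length ks) (\<lambda>U' E'. \<forall>k\<in>set ks. F k \<inter> E' \<noteq> {}) (U - F k) (insert e E)"
    proof (rule Cons.IH)
      fix l assume "l \<in> set ks"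
      then show "F l \<subseteq> U - F k \<and> card (F l) = q + 1"
        using Cons.prems(1) Cons.prems(2)[of l] Cons.prems(3)[of k l] by auto
    qed (use Cons.prems in auto)
    then have "force q (length ks) (\<lambda>U' E'. U - F k - (U - F k) \<subseteq> U' \<and> U' \<subseteq> U - F k \<and>
       insert e E \<subseteq> E' \<and> card (U - F k - U') \<le> length ks * (q + 1) \<and>
       (\<forall>k\<in>set ks. F k \<inter> E' \<noteq> {})) (U - F k) (insert e E)"
      by (rule force_frame) (use Cons.prems(4) in auto)
    then show "force q (length ks) (\<lambda>U' E'. \<forall>k\<in>set (k # ks). F k \<inter> E' \<noteq> {}) (U - F k) (insert e E)"
      by (rule force_mono) (use e in auto)
  qed
  then show ?case by simp
qed simp

section \<open>Rotations and boosters\<close>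

definition is_path :: "'a set set \<Rightarrow> 'a list \<Rightarrow> bool" where
  "is_path E p \<longleftrightarrow> p \<noteq> [] \<and> distinct p \<and> adjs p \<subseteq> E"

text \<open>These are Posa rotations with the first vertex fixed: an edge from the last vertex back
  to \<open>v\<close> replaces the path edge from \<open>v\<close> to \<open>w\<close>, and
  \<open>w\<close> becomes the new last vertex.\<close>

inductive rotations :: "'a set set \<Rightarrow> 'a list \<Rightarrow> 'a list \<Rightarrow> bool" for E p where
  refl: "rotations E p p"
| step: "rotations E p r \<Longrightarrow> r = u @ v # w # s \<Longrightarrow> {v, last (w # s)} \<in> E \<Longrightarrow>
    rotations E p (u @ v # rev (w # s))"

definition ends :: "'a set set \<Rightarrow> 'a list \<Rightarrow> 'a set" where
  "ends E p = {last r |r. rotations E p r}"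

lemma adjs_split:
  "adjs (u @ v # w # s) = adjs (u @ [v]) \<union> adjs (w # s) \<union> {{v, w}}"
  by (cases "u = []") (auto simp: adjs_append)

lemma adjs_rotate:
  "adjs (u @ v # rev (w # s)) = adjs (u @ [v]) \<union> adjs (w # s) \<union> {{v, last (w # s)}}"
proof -
  obtain x t where xt: "rev (w # s) = x # t" by (cases "rev (w # s)") auto
  then have "x = last (w # s)" by (metis hd_rev list.sel(1))
  moreover have "adjs (x # t) = adjs (w # s)" using adjs_rev[of "w # s"] unfolding xt .
  ultimately show ?thesis using adjs_split[of u v x t] unfolding xt by blast
qed

lemma rotations_path:
  "rotations E p r \<Longrightarrow> is_path E p \<Longrightarrow> is_path E r \<and> set r = set p \<and> hd r = hd p"
proof (induction rule: rotations.induct)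
  case (step r u v w s)
  have "adjs (u @ v # rev (w # s)) \<subseteq> E"
    using step adjs_split[of u v w s] unfolding adjs_rotate by (auto simp: is_path_def)
  moreover have "hd (u @ v # rev (w # s)) = hd r" using step by (cases u) auto
  ultimately show ?case using step by (auto simp: is_path_def)
qed simp

text \<open>The only edge that a rotation removes is the one from \<open>v\<close> to
  \<open>w\<close>, and at that moment \<open>w\<close> becomes an endpoint.\<close>

lemma rotations_keeps_adjs:
  "rotations E p r \<Longrightarrow> e \<in> adjs p \<Longrightarrow> e \<in> adjs r \<or> e \<inter> ends E p \<noteq> {}"
proof (induction rule: rotations.induct)
  case (step r u v w s)
  have "rotations E p (u @ v # rev (w # s))" by (rule rotations.step) fact+
  then have "last (u @ v # rev (w # s)) \<in> ends E p" unfolding ends_def by blast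
  then have "w \<in> ends E p" by simp
  then show ?case
    using step unfolding adjs_rotate by (auto simp: adjs_split)
qed simp

lemma adjs_at:
  assumes "distinct (u @ v # w # s)" "e \<in> adjs (u @ v # w # s)" "v \<in> e"
  shows "e = {v, w} \<or> (u \<noteq> [] \<and> e = {last u, v})"
proof -
  have "e \<notin> adjs (w # s)" "e \<notin> adjs u"
    using assms adjs_subset[of e] by fastforce+
  then show ?thesis using assms(2) by (cases "u = []") (auto simp: adjs_append)
qed

lemma adjs_doubleton: "e \<in> adjs p \<Longrightarrow> \<exists>a b. e = {a, b}"
  by (induction p rule: adjs.induct) auto

lemma card_adjs_neighbours:
  assumes "distinct p"
  shows "finite {v. {v, z} \<in> adjs p} \<and> card {v. {v, z} \<in> adjs p} \<le> 2"
proof (cases "z \<in> set p")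
  case False
  then have "{v. {v, z} \<in> adjs p} = {}" using adjs_subset[of _ p] by auto
  then show ?thesis by simp
next
  case True
  then obtain u s where p: "p = u @ z # s" by (metis split_list)
  have "{v. {v, z} \<in> adjs p} \<subseteq> {last u, hd s}"
  proof
    fix v assume "v \<in> {v. {v, z} \<in> adjs p}"
    then have v: "{v, z} \<in> adjs p" by simp
    have "{v, z} \<notin> adjs s" "{v, z} \<notin> adjs u"
      using assms adjs_subset[of "{v, z}"] by (auto simp: p)
    then show "v \<in> {last u, hd s}"
      using v by (cases "u = []"; cases "s = []")
        (auto simp: p adjs_append adjs_Cons doubleton_eq_iff)
  qed
  moreover have "card {last u, hd s} \<le> 2" by (simp add: card_insert_if)
  ultimately show ?thesis by (meson card_mono finite.emptyI finite.insertI finite_subset le_trans)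
qed

text \<open>If no neighbour of \<open>v\<close> on \<open>p\<close> were an endpoint, both edges of \<open>p\<close> at \<open>v\<close> would survive every rotation,
  and rotating at \<open>v\<close> would make one of these neighbours an endpoint.\<close>

lemma posa_neighbours:
  assumes p: "is_path E p" and y: "y \<in> ends E p" and vy: "{v, y} \<in> E"
    and v: "v \<in> set p" "v \<notin> ends E p"
  shows "\<exists>z\<in>ends E p. {v, z} \<in> adjs p"
proof (rule ccontr)
  assume no: "\<not> ?thesis"
  have keep: "e \<in> adjs r" if ep: "e \<in> adjs p" and ve: "v \<in> e" and pr: "rotations E p r" for e r
  proof (rule ccontr)
    assume "e \<notin> adjs r"
    then obtain z where "z \<in> e" "z \<in> ends E p" using rotations_keeps_adjs[OF pr ep] by blast
    moreover obtain a b where "e = {a, b}" using adjs_doubleton[OF ep] by blast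
    ultimately have "e = {v, z}" using ve v(2) by auto
    then show False using no ep \<open>z \<in> ends E p\<close> by blast
  qed
  obtain r where r: "rotations E p r" "last r = y" using y by (auto simp: ends_def)
  have path_r: "is_path E r" "set r = set p" "hd r = hd p" using rotations_path[OF r(1) p] by auto
  obtain u t where ut: "r = u @ v # t" using v(1) path_r(2) by (metis split_list)
  have "t \<noteq> []" using r(2) v(2) y ut by auto
  then obtain w s where t: "t = w # s" by (cases t) auto
  have r_eq: "r = u @ v # w # s" using ut t by simp
  have "{v, last (w # s)} \<in> E" using r(2) vy r_eq by simp
  then have "rotations E p (u @ v # rev (w # s))" by (rule rotations.step[OF r(1) r_eq])
  then have "last (u @ v # rev (w # s)) \<in> ends E p" unfolding ends_def by blast
  then have w: "w \<in> ends E p" by simp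
  \<comment> \<open>So \<open>p\<close> has at most one edge at \<open>v\<close>, the one to
    \<open>last u\<close>. But \<open>v\<close> has a successor on \<open>p\<close>, because
    \<open>last p\<close> is an endpoint and \<open>v\<close> is not. It also has a predecessor:
    otherwise it would be the first vertex of \<open>p\<close>, hence of \<open>r\<close>, although
    \<open>u\<close> is nonempty.\<close>
  have only: "u \<noteq> [] \<and> e = {last u, v}" if "e \<in> adjs p" "v \<in> e" for e
    using adjs_at[of u v w s e] keep[OF that r(1)] that no w path_r(1) by (auto simp: is_path_def r_eq)
  obtain u' t' where ut': "p = u' @ v # t'" using v(1) by (metis split_list)
  have "last p \<in> ends E p" unfolding ends_def using rotations.refl by blast
  then have "t' \<noteq> []" using v(2) ut' by auto
  then obtain w' s' where p_eq: "p = u' @ v # w' # s'" using ut' by (cases t') auto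
  have dp: "distinct p" using p by (simp add: is_path_def)
  have "{v, w'} \<in> adjs p" unfolding p_eq adjs_split by simp
  then have 1: "u \<noteq> []" "w' = last u"
    using only[of "{v, w'}"] dp by (auto simp: doubleton_eq_iff p_eq)
  show False
  proof (cases "u' = []")
    case True
    then have "hd r = v" using path_r(3) p_eq by simp
    then have "v \<in> set u" using 1(1) r_eq by (cases u) auto
    then show False using path_r(1) r_eq by (auto simp: is_path_def)
  next
    case False
    then have "{last u', v} \<in> adjs p" unfolding p_eq by (simp add: adjs_append)
    then have "last u' = last u"
      using only[of "{last u', v}"] dp False by (auto simp: doubleton_eq_iff p_eq)
    then have "w' \<in> set u'" using 1 False last_in_set[of u'] by simp
    then show False using dp p_eq by auto
  qed
qed

text \<open>The factor 2 and the strict inequality are chosen against Posa's bound: the endpoint set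
  of a path that cannot be extended has at most twice as many outside neighbours as
  elements.\<close>

definition expands :: "'a set set \<Rightarrow> 'a set \<Rightarrow> nat \<Rightarrow> bool" where
  "expands E U k \<longleftrightarrow> (\<forall>S\<subseteq>U. S \<noteq> {} \<and> card S \<le> k \<longrightarrow>
     2 * card S < card {v \<in> U - S. \<exists>s\<in>S. {v, s} \<in> E})"

text \<open>By \<open>posa_neighbours\<close>, every outside neighbour of the endpoint set is next
  to an endpoint on \<open>p\<close>, and each endpoint has at most two neighbours on
  \<open>p\<close>. So the endpoint set violates the expansion inequality and must have more than
  \<open>k\<close> elements.\<close>

lemma posa:
  assumes p: "is_path E p" "set p \<subseteq> U" and ex: "expands E U k" and "finite U"
    and stuck: "\<And>y v. y \<in> ends E p \<Longrightarrow> v \<in> U \<Longrightarrow> {v, y} \<in> E \<Longrightarrow> v \<in> set p"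
  shows "k < card (ends E p)"
proof (rule ccontr)
  let ?S = "ends E p"
  assume "\<not> ?thesis"
  moreover have "?S \<subseteq> U"
  proof
    fix x assume "x \<in> ?S"
    then obtain r where "rotations E p r" "x = last r" by (auto simp: ends_def)
    moreover have "is_path E r" "set r = set p" using rotations_path[OF \<open>rotations E p r\<close> p(1)] by auto
    ultimately show "x \<in> U" using p(2) last_in_set[of r] by (auto simp: is_path_def)
  qed
  moreover have "last p \<in> ?S" unfolding ends_def using rotations.refl by blast
  ultimately have "2 * card ?S < card {v \<in> U - ?S. \<exists>s\<in>?S. {v, s} \<in> E}"
    using ex[unfolded expands_def, rule_format, of ?S] by auto
  moreover have "card {v \<in> U - ?S. \<exists>s\<in>?S. {v, s} \<in> E} \<le> 2 * card ?S"
  proof -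
    have finS: "finite ?S" using \<open>?S \<subseteq> U\<close> assms(4) finite_subset by blast
    have d: "distinct p" using p by (simp add: is_path_def)
    have "{v \<in> U - ?S. \<exists>s\<in>?S. {v, s} \<in> E} \<subseteq> (\<Union>z\<in>?S. {v. {v, z} \<in> adjs p})"
      using posa_neighbours[OF p(1)] stuck by blast
    then have "card {v \<in> U - ?S. \<exists>s\<in>?S. {v, s} \<in> E} \<le> card (\<Union>z\<in>?S. {v. {v, z} \<in> adjs p})"
      using finS card_adjs_neighbours[OF d] by (intro card_mono) auto
    also have "\<dots> \<le> (\<Sum>z\<in>?S. card {v. {v, z} \<in> adjs p})" by (rule card_UN_le[OF finS])
    also have "\<dots> \<le> (\<Sum>z\<in>?S. 2)" using card_adjs_neighbours[OF d] by (intro sum_mono) auto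
    finally show ?thesis by simp
  qed
  ultimately show False by simp
qed

text \<open>A Hamilton path of the subgraph on \<open>C\<close>. Its pairs of ends are the boosters:
  adding such a pair closes a cycle on \<open>C\<close>.\<close>

definition spans :: "'a set set \<Rightarrow> 'a set \<Rightarrow> 'a \<Rightarrow> 'a \<Rightarrow> bool" where
  "spans E C y z \<longleftrightarrow> (\<exists>p. is_path E p \<and> set p = C \<and> hd p = y \<and> last p = z)"

lemma spans_sym: "spans E C y z \<Longrightarrow> spans E C z y"
  unfolding spans_def is_path_def
  by (metis adjs_rev distinct_rev hd_rev last_rev rev_is_Nil_conv set_rev)

lemma spans_in: "spans E C y z \<Longrightarrow> y \<in> C \<and> z \<in> C"
  unfolding spans_def is_path_def by auto

text \<open>Rotating with first vertex \<open>y0\<close> yields more than \<open>k\<close> last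
  vertices. Reversing the paths makes each of these a first vertex, and rotating again yields more
  than \<open>k\<close> partners for each. Every unordered pair arises from at most two ordered
  ones.\<close>

lemma card_boosters:
  assumes "finite U" "C \<subseteq> U" and ex: "expands E U k" and start: "spans E C y0 z0"
    and stuck: "\<And>y z v. spans E C y z \<Longrightarrow> v \<in> U \<Longrightarrow> {v, z} \<in> E \<Longrightarrow> v \<in> C"
  shows "k < card C" "k * k \<le> 2 * card {{y, z} |y z. spans E C y z}"
proof -
  have many: "\<exists>Z. k < card Z \<and> finite Z \<and> (\<forall>z\<in>Z. spans E C y z)" if yz: "spans E C y z'" for y z'
  proof -
    obtain p where p: "is_path E p" "set p = C" "hd p = y" using yz by (auto simp: spans_def)
    have sp: "spans E C y z" if "z \<in> ends E p" for z
      using that rotations_path[OF _ p(1)] p unfolding ends_def spans_def by blast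
    have "k < card (ends E p)"
    proof (rule posa[OF p(1) _ ex assms(1)])
      show "set p \<subseteq> U" using p(2) assms(2) by simp
      show "v \<in> set p" if "x \<in> ends E p" "v \<in> U" "{v, x} \<in> E" for x v
        using stuck[OF sp] that p(2) by simp
    qed
    then show ?thesis using sp card.infinite by (intro exI[of _ "ends E p"]) fastforce
  qed
  obtain Y where Y: "k < card Y" "finite Y" "\<forall>y\<in>Y. spans E C y0 y" using many[OF start] by blast
  have "\<forall>y\<in>Y. \<exists>Z. k < card Z \<and> finite Z \<and> (\<forall>z\<in>Z. spans E C y z)"
    using Y(3) many spans_sym by metis
  then obtain Z where Z: "\<And>y. y \<in> Y \<Longrightarrow> k < card (Z y) \<and> finite (Z y) \<and> (\<forall>z\<in>Z y. spans E C y z)"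
    by metis
  let ?R = "{(y, z). spans E C y z}" and ?B = "{{y, z} |y z. spans E C y z}"
  have finC: "finite C" using assms(1,2) finite_subset by blast
  have "Y \<subseteq> C" using Y(3) by (auto dest: spans_in)
  then show "k < card C" using card_mono[OF finC, of Y] Y(1) by linarith
  have finR: "finite ?R" by (rule finite_subset[of _ "C \<times> C"]) (use finC spans_in in \<open>auto dest: spans_in\<close>)
  have B: "?B = (\<lambda>(y, z). {y, z}) ` ?R" by auto
  have "k * k \<le> card Y * k" using Y by simp
  also have "\<dots> \<le> (\<Sum>y\<in>Y. card (Z y))" using sum_mono[of Y "\<lambda>_. k" "\<lambda>y. card (Z y)"] Z by (simp add: less_imp_le)
  also have "\<dots> = card (Sigma Y Z)" using Y Z by simp
  also have "\<dots> \<le> card ?R" by (rule card_mono[OF finR]) (use Z in auto)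
  also have "?R \<subseteq> (\<Union>e\<in>?B. {(y, z). {y, z} = e})" by blast
  then have "card ?R \<le> card (\<Union>e\<in>?B. {(y, z). {y, z} = e})"
  proof (rule card_mono[rotated])
    have "finite {(y, z). {y, z} = e}" if "finite e" for e :: "'a set"
      by (rule finite_subset[of _ "e \<times> e"]) (use that in auto)
    then show "finite (\<Union>e\<in>?B. {(y, z). {y, z} = e})" using finR unfolding B by auto
  qed
  also have "\<dots> \<le> (\<Sum>e\<in>?B. card {(y, z). {y, z} = e})" by (rule card_UN_le) (use finR B in simp)
  also have "\<dots> \<le> (\<Sum>e\<in>?B. 2)"
  proof (rule sum_mono)
    fix e assume "e \<in> ?B"
    then obtain a b where "e = {a, b}" by blast
    then have "{(y, z). {y, z} = e} \<subseteq> {(a, b), (b, a)}" by (auto simp: doubleton_eq_iff)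
    then have "card {(y, z). {y, z} = e} \<le> card {(a, b), (b, a)}" by (intro card_mono) auto
    also have "\<dots> \<le> 2" using card_length[of "[(a, b), (b, a)]"] by simp
    finally show "card {(y, z). {y, z} = e} \<le> 2" .
  qed
  finally show "k * k \<le> 2 * card {{y, z} |y z. spans E C y z}" by simp
qed

definition cycle_on :: "'a set set \<Rightarrow> 'a set \<Rightarrow> bool" where
  "cycle_on E C \<longleftrightarrow> (\<exists>vs. 3 \<le> length vs \<and> distinct vs \<and> set vs = C \<and> cyc_edges vs \<subseteq> E)"

lemma cycle_on_mono: "cycle_on E C \<Longrightarrow> E \<subseteq> E' \<Longrightarrow> cycle_on E' C"
  unfolding cycle_on_def by blast

lemma spans_close:
  assumes "spans E C y z" "3 \<le> card C"
  shows "cycle_on (insert {y, z} E) C"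
proof -
  obtain p where "is_path E p" "set p = C" "hd p = y" "last p = z" using assms(1) by (auto simp: spans_def)
  then show ?thesis
    using assms(2) unfolding cycle_on_def
    by (intro exI[of _ p]) (auto simp: is_path_def cyc_edges_def distinct_card insert_commute)
qed

lemma cycle_on_extend:
  assumes "cycle_on E C" "c \<in> C" "v \<notin> C" "{v, c} \<in> E"
  shows "\<exists>z. spans E (insert v C) v z"
proof -
  obtain vs where vs: "distinct vs" "set vs = C" "cyc_edges vs \<subseteq> E" "3 \<le> length vs"
    using assms(1) by (auto simp: cycle_on_def)
  obtain i where i: "i < length vs" "vs ! i = c" using assms(2) vs(2) by (auto simp: in_set_conv_nth)
  let ?r = "rotate i vs"
  have ne: "?r \<noteq> []" using vs by auto
  have "hd ?r = c" using i hd_rotate_conv_nth[of vs i] vs(4) by fastforce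
  moreover have "adjs ?r \<subseteq> E" using vs(3) cyc_edges_rotate[of i vs] unfolding cyc_edges_def by blast
  ultimately have "is_path E (v # ?r)"
    using vs ne assms(3,4) by (simp add: is_path_def adjs_Cons)
  then show ?thesis unfolding spans_def using vs(2)
    by (intro exI[of _ "last (v # ?r)"] exI[of _ "v # ?r"]) simp
qed

section \<open>Forcing matchings, stars, paths and short cycles\<close>

lemma force_keep:
  assumes "force q r G U E" "finite U"
  shows "force q r (\<lambda>U' E'. U' \<subseteq> U \<and> E \<subseteq> E' \<and> card (U - U') \<le> r * (q + 1) \<and> G U' E') U E"
  using force_frame[OF assms(1) order_refl assms(2)] by (rule force_mono) (auto simp: Int_absorb2)

lemma inj_on_doubleton: "x \<notin> W \<Longrightarrow> inj_on (\<lambda>w. {x, w}) W"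
  by (auto simp: inj_on_def doubleton_eq_iff)

text \<open>The last conclusion holds because \<open>ts ! i\<close> is no longer offered once it is matched.\<close>

lemma force_matching:
  assumes "distinct xs" "finite T" "set xs \<inter> T = {}" "length xs + q \<le> card T"
    and "\<And>x t. x \<in> set xs \<Longrightarrow> t \<in> T \<Longrightarrow> {x, t} \<in> U" "finite U"
  shows "force q (length xs) (\<lambda>U' E'. \<exists>ts. length ts = length xs \<and> distinct ts \<and> set ts \<subseteq> T \<and>
     (\<forall>i<length xs. {xs ! i, ts ! i} \<in> E') \<and>
     (\<forall>i j. i < j \<longrightarrow> j < length xs \<longrightarrow> {xs ! j, ts ! i} \<in> U')) U E"
  using assms
proof (induction xs arbitrary: T U E)
  case (Cons x xs T U E)
  let ?G = "\<lambda>xs T U' E'. \<exists>ts. length ts = length xs \<and> distinct ts \<and> set ts \<subseteq> T \<and>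
     (\<forall>i<length xs. {xs ! i, ts ! i} \<in> E') \<and>
     (\<forall>i j. i < j \<longrightarrow> j < length xs \<longrightarrow> {xs ! j, ts ! i} \<in> U')"
  have "q + 1 \<le> card T" using Cons.prems(4) by simp
  then obtain W where W: "W \<subseteq> T" "card W = q + 1" by (rule obtain_subset_with_card_n)
  have "force q (Suc (length xs)) (?G (x # xs) T) U E"
  proof (rule force_step)
    show "(\<lambda>t. {x, t}) ` W \<subseteq> U" using W Cons.prems(5) by auto
    show "card ((\<lambda>t. {x, t}) ` W) = q + 1"
      using W Cons.prems(3) by (subst card_image) (auto intro!: inj_on_doubleton)
    fix e assume "e \<in> (\<lambda>t. {x, t}) ` W"
    then obtain t where t: "t \<in> W" "e = {x, t}" by auto
    let ?F = "(\<lambda>t. {x, t}) ` W"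
    \<comment> \<open>The rest of the matching is confined to a board without \<open>t\<close>, so
      by \<open>force_frame\<close> the edges from later vertices to \<open>t\<close> stay
      unclaimed.\<close>
    define H where "H = (\<lambda>(y, s). {y, s}) ` (set xs \<times> (T - {t}))"
    have HU: "H \<subseteq> U - ?F"
      using Cons.prems(1,3,5) W(1) by (auto simp: H_def doubleton_eq_iff)
    have "force q (length xs) (?G xs (T - {t})) H (insert e E)"
    proof (rule Cons.IH)
      have "t \<in> T" using t W by auto
      then show "length xs + q \<le> card (T - {t})" using Cons.prems(2,4) by simp
      show "\<And>y s. y \<in> set xs \<Longrightarrow> s \<in> T - {t} \<Longrightarrow> {y, s} \<in> H" by (auto simp: H_def)
      show "finite H" using Cons.prems(2) by (simp add: H_def)
    qed (use Cons.prems in auto)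
    then have "force q (length xs) (\<lambda>U' E'. U - ?F - H \<subseteq> U' \<and> U' \<subseteq> U - ?F \<and> insert e E \<subseteq> E' \<and>
       card (U - ?F - U') \<le> length xs * (q + 1) \<and> ?G xs (T - {t}) (U' \<inter> H) E') (U - ?F) (insert e E)"
      by (rule force_frame[OF _ HU]) (use Cons.prems(6) in auto)
    then show "force q (length xs) (?G (x # xs) T) (U - ?F) (insert e E)"
    proof (rule force_mono)
      fix U' E'
      assume *: "U - ?F - H \<subseteq> U' \<and> U' \<subseteq> U - ?F \<and> insert e E \<subseteq> E' \<and>
       card (U - ?F - U') \<le> length xs * (q + 1) \<and> ?G xs (T - {t}) (U' \<inter> H) E'"
      then have U': "U - ?F - H \<subseteq> U'" "insert e E \<subseteq> E'" and ex: "?G xs (T - {t}) (U' \<inter> H) E'" by simp_all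
      from ex obtain ts where ts: "length ts = length xs" "distinct ts" "set ts \<subseteq> T - {t}"
        "\<forall>i<length xs. {xs ! i, ts ! i} \<in> E'"
        "\<forall>i j. i < j \<longrightarrow> j < length xs \<longrightarrow> {xs ! j, ts ! i} \<in> U' \<inter> H" by (elim exE conjE)
      have tT: "t \<in> T" using t W by auto
      have free: "{y, t} \<in> U'" if "y \<in> set xs" for y
      proof -
        have "{y, t} \<in> U" using that Cons.prems(5) tT by simp
        moreover have "{y, t} \<notin> ?F" using that Cons.prems(1,3) W(1) tT by (auto simp: doubleton_eq_iff)
        moreover have "{y, t} \<notin> H"
          using that Cons.prems(3) by (auto simp: H_def doubleton_eq_iff)
        ultimately show ?thesis using U' by blast
      qed
      show "?G (x # xs) T U' E'"
      proof (intro exI[of _ "t # ts"] conjI allI impI)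
        fix i assume "i < length (x # xs)"
        then show "{(x # xs) ! i, (t # ts) ! i} \<in> E'" using ts(4) U'(2) t(2) by (cases i) auto
      next
        fix i j assume "i < j" "j < length (x # xs)"
        then obtain j' where j': "j = Suc j'" "j' < length xs" by (cases j) auto
        show "{(x # xs) ! j, (t # ts) ! i} \<in> U'"
        proof (cases i)
          case 0
          then show ?thesis using free[of "xs ! j'"] j' by simp
        next
          case (Suc i')
          then show ?thesis using ts(5)[rule_format, of i' j'] j' \<open>i < j\<close> by simp
        qed
      qed (use ts tT in auto)
    qed
  qed
  then show ?case by simp
qed simp

text \<open>\<open>T\<close> has room for \<open>d\<close> disjoint blocks of size
  \<open>length xs + q\<close>, and one matching is forced into each block. A star consists of the
  partners of its centre; they are distinct because the blocks are disjoint.\<close>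

lemma force_stars:
  assumes "distinct xs" "finite T" "set xs \<inter> T = {}" "d * (length xs + q) \<le> card T"
    and "\<And>x t. x \<in> set xs \<Longrightarrow> t \<in> T \<Longrightarrow> {x, t} \<in> U" "finite U"
  shows "force q (d * length xs) (\<lambda>U' E'. \<exists>g.
     (\<forall>x\<in>set xs. g x \<subseteq> T \<and> card (g x) = d \<and> (\<forall>t\<in>g x. {x, t} \<in> E')) \<and>
     (\<forall>x\<in>set xs. \<forall>y\<in>set xs. x \<noteq> y \<longrightarrow> g x \<inter> g y = {})) U E"
  using assms(2-)
proof (induction d arbitrary: T U E)
  case 0
  show ?case by (rule force_now, rule exI[of _ "\<lambda>_. {}"]) simp
next
  case (Suc d T U E)
  let ?G = "\<lambda>d T U' E'. \<exists>g.
     (\<forall>x\<in>set xs. g x \<subseteq> T \<and> card (g x) = d \<and> (\<forall>t\<in>g x. {x, t} \<in> E')) \<and>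
     (\<forall>x\<in>set xs. \<forall>y\<in>set xs. x \<noteq> y \<longrightarrow> g x \<inter> g y = {})"
  have "length xs + q \<le> card T" using Suc.prems(3) by simp
  then obtain S where S: "S \<subseteq> T" "card S = length xs + q" by (rule obtain_subset_with_card_n)
  define H where "H = (\<lambda>(y, s). {y, s}) ` (set xs \<times> S)"
  have finS: "finite S" using S Suc.prems(1) finite_subset by blast
  have HU: "H \<subseteq> U" using S Suc.prems(4) by (auto simp: H_def)
  have m: "force q (length xs) (\<lambda>U' E'. \<exists>ts. length ts = length xs \<and> distinct ts \<and> set ts \<subseteq> S \<and>
     (\<forall>i<length xs. {xs ! i, ts ! i} \<in> E') \<and>
     (\<forall>i j. i < j \<longrightarrow> j < length xs \<longrightarrow> {xs ! j, ts ! i} \<in> U')) H E"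
    using assms(1) S finS Suc.prems(2) by (intro force_matching) (auto simp: H_def)
  have "force q (length xs + d * length xs) (?G (Suc d) T) U E"
  proof (rule force_compose[OF m HU Suc.prems(5)])
    fix U' E'
    assume *: "U - H \<subseteq> U'" "U' \<subseteq> U"
      "\<exists>ts. length ts = length xs \<and> distinct ts \<and> set ts \<subseteq> S \<and>
     (\<forall>i<length xs. {xs ! i, ts ! i} \<in> E') \<and>
     (\<forall>i j. i < j \<longrightarrow> j < length xs \<longrightarrow> {xs ! j, ts ! i} \<in> U' \<inter> H)"
    then obtain ts where ts: "length ts = length xs" "distinct ts" "set ts \<subseteq> S"
      "\<forall>i<length xs. {xs ! i, ts ! i} \<in> E'" by (elim exE conjE)
    define f where "f = (\<lambda>x. ts ! (THE i. i < length xs \<and> xs ! i = x))"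
    have f: "f (xs ! i) = ts ! i" if "i < length xs" for i
    proof -
      have "(THE j. j < length xs \<and> xs ! j = xs ! i) = i"
        by (rule the_equality) (use that assms(1) in \<open>auto simp: nth_eq_iff_index_eq\<close>)
      then show ?thesis by (simp add: f_def)
    qed
    have f1: "f x \<in> S \<and> {x, f x} \<in> E'" if "x \<in> set xs" for x
      using that f ts by (auto simp: in_set_conv_nth subset_iff)
    have f2: "f x \<noteq> f y" if "x \<in> set xs" "y \<in> set xs" "x \<noteq> y" for x y
      using that f ts by (auto simp: in_set_conv_nth nth_eq_iff_index_eq)
    have finU': "finite U'" using *(2) Suc.prems(5) finite_subset by blast
    have "force q (d * length xs) (?G d (T - S)) U' E'"
    proof (rule Suc.IH)
      show "d * (length xs + q) \<le> card (T - S)"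
        using S Suc.prems(1,3) finS by (simp add: card_Diff_subset)
      show "{x, t} \<in> U'" if "x \<in> set xs" "t \<in> T - S" for x t
      proof -
        have "{x, t} \<notin> H" using that Suc.prems(2) S by (auto simp: H_def doubleton_eq_iff)
        then show ?thesis using that Suc.prems(4) *(1) by auto
      qed
    qed (use Suc.prems finU' in auto)
    from force_keep[OF this finU'] show "force q (d * length xs) (?G (Suc d) T) U' E'"
    proof (rule force_mono)
      fix U'' E''
      assume "U'' \<subseteq> U' \<and> E' \<subseteq> E'' \<and> card (U' - U'') \<le> d * length xs * (q + 1) \<and> ?G d (T - S) U'' E''"
      then have E: "E' \<subseteq> E''" and ex: "?G d (T - S) U'' E''" by simp_all
      from ex obtain g where g: "\<forall>x\<in>set xs. g x \<subseteq> T - S \<and> card (g x) = d \<and> (\<forall>t\<in>g x. {x, t} \<in> E'')"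
          "\<forall>x\<in>set xs. \<forall>y\<in>set xs. x \<noteq> y \<longrightarrow> g x \<inter> g y = {}" by (elim exE conjE)
      define g' where "g' = (\<lambda>x. insert (f x) (g x))"
      have "g' x \<subseteq> T \<and> card (g' x) = Suc d \<and> (\<forall>t\<in>g' x. {x, t} \<in> E'')" if x: "x \<in> set xs" for x
      proof -
        have "g x \<subseteq> T - S" using g(1) x by simp
        then have "finite (g x)" "f x \<notin> g x" using f1[OF x] Suc.prems(1) by (auto intro: finite_subset)
        then show ?thesis using g(1) x f1[OF x] S E by (auto simp: g'_def)
      qed
      moreover have "g' x \<inter> g' y = {}" if xy: "x \<in> set xs" "y \<in> set xs" "x \<noteq> y" for x y
      proof -
        have "g x \<inter> g y = {}" "g x \<subseteq> T - S" "g y \<subseteq> T - S" using g xy by auto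
        then show ?thesis using f1[OF xy(1)] f1[OF xy(2)] f2[OF xy] by (auto simp: g'_def)
      qed
      ultimately show "?G (Suc d) T U'' E''" by blast
    qed
  qed
  then show ?case by simp
qed

lemma force_path:
  assumes "finite W" "x \<notin> W" "r + q \<le> card W"
    and "\<And>a b. a \<in> insert x W \<Longrightarrow> b \<in> insert x W \<Longrightarrow> a \<noteq> b \<Longrightarrow> {a, b} \<in> U" "finite U"
  shows "force q r (\<lambda>U' E'. \<exists>p. is_path E' p \<and> length p = Suc r \<and> set p \<subseteq> insert x W \<and> hd p = x) U E"
  using assms
proof (induction r arbitrary: W x U E)
  case (0 W x U E)
  show ?case by (rule force_now, rule exI[of _ "[x]"]) (simp add: is_path_def)
next
  case (Suc r W x U E)
  let ?G = "\<lambda>r x W U' E'. \<exists>p. is_path E' p \<and> length p = Suc r \<and> set p \<subseteq> insert x W \<and> hd p = x"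
  have "q + 1 \<le> card W" using Suc.prems(3) by simp
  then obtain S where S: "S \<subseteq> W" "card S = q + 1" by (rule obtain_subset_with_card_n)
  let ?F = "(\<lambda>t. {x, t}) ` S"
  show ?case
  proof (rule force_step)
    show "?F \<subseteq> U" using S Suc.prems(2,4) by auto
    show "card ?F = q + 1" using S Suc.prems(2) by (subst card_image) (auto intro!: inj_on_doubleton)
    fix e assume "e \<in> ?F"
    then obtain t where t: "t \<in> S" "e = {x, t}" by auto
    have fin: "finite (U - ?F)" using Suc.prems(5) by simp
    have tW: "t \<in> W" using t S by auto
    have "force q r (?G r t (W - {t})) (U - ?F) (insert e E)"
    proof (rule Suc.IH)
      show "r + q \<le> card (W - {t})" using Suc.prems(1,3) tW by simp
      show "{a, b} \<in> U - ?F" if "a \<in> insert t (W - {t})" "b \<in> insert t (W - {t})" "a \<noteq> b" for a b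
        using that tW Suc.prems(2,4) by (auto simp: doubleton_eq_iff)
    qed (use Suc.prems in auto)
    from force_keep[OF this fin] show "force q r (?G (Suc r) x W) (U - ?F) (insert e E)"
    proof (rule force_mono)
      fix U' E'
      assume "U' \<subseteq> U - ?F \<and> insert e E \<subseteq> E' \<and> card (U - ?F - U') \<le> r * (q + 1) \<and> ?G r t (W - {t}) U' E'"
      then obtain p where p: "e \<in> E'" "is_path E' p" "length p = Suc r" "set p \<subseteq> insert t (W - {t})" "hd p = t"
        by (elim exE conjE) simp
      then show "?G (Suc r) x W U' E'"
        using tW t Suc.prems(2) by (intro exI[of _ "x # p"]) (auto simp: is_path_def adjs_Cons)
    qed
  qed
qed

lemma adjs_sublist: "adjs (take m (drop i p)) \<subseteq> adjs p"
proof -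
  have "adjs xs \<subseteq> adjs (xs @ ys)" "adjs ys \<subseteq> adjs (xs @ ys)" for xs ys :: "'a list"
    by (cases "xs = []"; cases "ys = []"; auto simp: adjs_append)+
  then show ?thesis by (metis append_take_drop_id order_trans)
qed

definition has_cycle_within :: "'a set set \<Rightarrow> 'a set \<Rightarrow> nat \<Rightarrow> bool" where
  "has_cycle_within E V k \<longleftrightarrow> (\<exists>C\<subseteq>V. card C = k \<and> cycle_on E C)"

text \<open>Waiter builds a path \<open>p\<close> in \<open>A\<close> and matches its first \<open>q + 1\<close> vertices to vertices \<open>ts ! i\<close> of \<open>B\<close>. Each of
  the \<open>q + 1\<close> edges from \<open>ts ! i\<close> to \<open>p ! (i + k - 2)\<close> closes a cycle of length \<open>k\<close>, and for distinct \<open>k\<close>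
  these sets of edges are disjoint.\<close>

lemma force_short_cycles:
  assumes "finite A" "finite B" "A \<inter> B = {}" "K + 2 * q + 1 \<le> card A" "2 * q + 1 \<le> card B"
    and edges: "\<And>a b. a \<in> A \<union> B \<Longrightarrow> b \<in> A \<union> B \<Longrightarrow> a \<noteq> b \<Longrightarrow> {a, b} \<in> U" and finU: "finite U"
  shows "force q ((K + q) + ((q + 1) + (K - 2)))
     (\<lambda>U' E'. \<forall>k. 3 \<le> k \<and> k \<le> K \<longrightarrow> has_cycle_within E' (A \<union> B) k) U E"
proof -
  let ?G = "\<lambda>U' E'. \<forall>k. 3 \<le> k \<and> k \<le> K \<longrightarrow> has_cycle_within E' (A \<union> B) k"
  have "A \<noteq> {}" using assms(4) by auto
  then obtain x where x: "x \<in> A" by blast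
  define H where "H = {{a, b} |a b. a \<in> A \<and> b \<in> A \<and> a \<noteq> b}"
  have HU: "H \<subseteq> U" using edges by (auto simp: H_def)
  \<comment> \<open>With \<open>K + q + 1\<close> vertices on the path, all positions
    \<open>i + k - 2\<close> for \<open>i\<close> up to \<open>q\<close> and \<open>k\<close> up to
    \<open>K\<close> exist.\<close>
  have "force q (K + q) (\<lambda>U' E'. \<exists>p. is_path E' p \<and> length p = Suc (K + q) \<and> set p \<subseteq> insert x (A - {x}) \<and> hd p = x) H E"
    by (rule force_path) (use x assms(1,4) HU finU in \<open>auto simp: H_def intro: finite_subset\<close>)
  then show ?thesis
  proof (rule force_compose[OF _ HU finU])
    fix U1 E1
    assume 1: "U - H \<subseteq> U1" "U1 \<subseteq> U"
      and "\<exists>p. is_path E1 p \<and> length p = Suc (K + q) \<and> set p \<subseteq> insert x (A - {x}) \<and> hd p = x"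
    then obtain p where p: "is_path E1 p" "length p = Suc (K + q)" "set p \<subseteq> A" using x by blast
    have dp: "distinct p" using p by (simp add: is_path_def)
    have finU1: "finite U1" using 1 finU finite_subset by blast
    have cross: "{a, b} \<in> U1" if "a \<in> A" "b \<in> B" for a b
    proof -
      have "{a, b} \<notin> H" using that assms(3) by (auto simp: H_def doubleton_eq_iff)
      moreover have "{a, b} \<in> U" using that assms(3) by (intro edges) auto
      ultimately show ?thesis using 1 by blast
    qed
    define xs where "xs = take (q + 1) p"
    have lxs: "length xs = q + 1" using p(2) by (simp add: xs_def)
    have xs_nth: "xs ! i = p ! i" if "i \<le> q" for i using that by (simp add: xs_def)
    have sxs: "set xs \<subseteq> A" "distinct xs" using p(3) set_take_subset[of "q + 1" p] dp by (auto simp: xs_def)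
    define H2 where "H2 = (\<lambda>(y, s). {y, s}) ` (set xs \<times> B)"
    have H2U: "H2 \<subseteq> U1" using cross sxs by (auto simp: H2_def)
    have "force q (length xs) (\<lambda>U' E'. \<exists>ts. length ts = length xs \<and> distinct ts \<and> set ts \<subseteq> B \<and>
     (\<forall>i<length xs. {xs ! i, ts ! i} \<in> E') \<and>
     (\<forall>i j. i < j \<longrightarrow> j < length xs \<longrightarrow> {xs ! j, ts ! i} \<in> U')) H2 E1"
      by (rule force_matching) (use sxs lxs assms(2,3,5) in \<open>auto simp: H2_def\<close>)
    then show "force q ((q + 1) + (K - 2)) ?G U1 E1"
      unfolding lxs
    proof (rule force_compose[OF _ H2U finU1])
      fix U2 E2
      assume 2: "U1 - H2 \<subseteq> U2" "U2 \<subseteq> U1" "E1 \<subseteq> E2"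
        and "\<exists>ts. length ts = q + 1 \<and> distinct ts \<and> set ts \<subseteq> B \<and>
         (\<forall>i<q + 1. {xs ! i, ts ! i} \<in> E2) \<and>
         (\<forall>i j. i < j \<longrightarrow> j < q + 1 \<longrightarrow> {xs ! j, ts ! i} \<in> U2 \<inter> H2)"
      then obtain ts where ts0: "length ts = q + 1" "distinct ts" "set ts \<subseteq> B"
         "\<forall>i<q + 1. {xs ! i, ts ! i} \<in> E2"
         "\<forall>i j. i < j \<longrightarrow> j < q + 1 \<longrightarrow> {xs ! j, ts ! i} \<in> U2 \<inter> H2" by (elim exE conjE)
      note ts = ts0(1-3)
      have matched: "{p ! i, ts ! i} \<in> E2" if "i \<le> q" for i
        using ts0(4)[rule_format, of i] that xs_nth by simp
      have later: "{p ! j, ts ! i} \<in> U2" if "i < j" "j \<le> q" for i j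
        using ts0(5)[rule_format, of i j] that xs_nth by simp
      have finU2: "finite U2" using 2 finU1 finite_subset by blast
      have tsB: "ts ! i \<in> B" if "i \<le> q" for i using that ts(1,3) nth_mem[of i ts] by auto
      have pA: "p ! j \<in> A" if "j \<le> K + q" for j using that p(2,3) nth_mem[of j p] by auto
      \<comment> \<open>Closing edges have j = i + k - 2 > i because k >= 3. Up to position
        \<open>q\<close> such an edge survives by the last conclusion of
        \<open>force_matching\<close>; beyond it, \<open>p ! j\<close> does not take part in the
        matching at all.\<close>
      have free: "{p ! j, ts ! i} \<in> U2" if "i < j" "i \<le> q" "j \<le> K + q" for i j
      proof (cases "j \<le> q")
        case True
        then show ?thesis using later that by simp
      next
        case False
        have "p ! j \<notin> set xs"
        proof
          assume "p ! j \<in> set xs"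
          then obtain i where "i \<le> q" "p ! i = p ! j" using lxs xs_nth by (auto simp: in_set_conv_nth less_Suc_eq_le)
          then show False using False dp that p(2) by (simp add: nth_eq_iff_index_eq)
        qed
        then have "{p ! j, ts ! i} \<notin> H2"
          using tsB[OF that(2)] pA[OF that(3)] assms(3) by (auto simp: H2_def doubleton_eq_iff)
        moreover have "{p ! j, ts ! i} \<in> U1" using tsB[OF that(2)] pA[OF that(3)] cross by simp
        ultimately show ?thesis using 2 by blast
      qed
      define F where "F = (\<lambda>k. (\<lambda>i. {p ! (i + k - 2), ts ! i}) ` {..q})"
      have eq: "i = j \<and> k = l"
        if "{p ! (i + k - 2), ts ! i} = {p ! (j + l - 2), ts ! j}" "i \<le> q" "j \<le> q"
          "k \<in> {3..K}" "l \<in> {3..K}" for i j k l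
      proof -
        have "p ! (i + k - 2) \<in> A" "p ! (j + l - 2) \<in> A" using that by (auto intro!: pA)
        then have "p ! (i + k - 2) = p ! (j + l - 2)" "ts ! i = ts ! j"
          using that tsB[of i] tsB[of j] assms(3) by (auto simp: doubleton_eq_iff)
        then have "i + k - 2 = j + l - 2" "i = j"
          using dp p(2) ts(1,2) that by (auto simp: nth_eq_iff_index_eq)
        then show ?thesis using that by auto
      qed
      have "force q (length [3..<K + 1]) (\<lambda>U' E'. \<forall>k\<in>set [3..<K + 1]. F k \<inter> E' \<noteq> {}) U2 E2"
      proof (rule force_one_of_each)
        fix k assume k: "k \<in> set [3..<K + 1]"
        have "inj_on (\<lambda>i. {p ! (i + k - 2), ts ! i}) {..q}"
          using eq[of _ k _ k] k by (auto simp: inj_on_def)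
        then have "card (F k) = q + 1" by (simp add: F_def card_image)
        moreover have "F k \<subseteq> U2" using k by (auto simp: F_def intro!: free)
        ultimately show "F k \<subseteq> U2 \<and> card (F k) = q + 1" by simp
      next
        fix k l assume "k \<in> set [3..<K + 1]" "l \<in> set [3..<K + 1]" "k \<noteq> l"
        then show "F k \<inter> F l = {}" using eq[of _ k _ l] unfolding F_def by auto
      qed (use finU2 in auto)
      from force_keep[OF this finU2]
      have "force q (length [3..<K + 1]) ?G U2 E2"
      proof (rule force_mono, intro allI impI)
        fix U3 E3 k
        assume 3: "U3 \<subseteq> U2 \<and> E2 \<subseteq> E3 \<and> card (U2 - U3) \<le> length [3..<K + 1] * (q + 1) \<and>
            (\<forall>k\<in>set [3..<K + 1]. F k \<inter> E3 \<noteq> {})" and k: "3 \<le> k \<and> k \<le> K"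
        have "k \<in> set [3..<K + 1]" using k by auto
        then have "F k \<inter> E3 \<noteq> {}" using 3 by blast
        then obtain i where i: "i \<le> q" "{p ! (i + k - 2), ts ! i} \<in> E3" by (auto simp: F_def)
        define s where "s = take (k - 1) (drop i p)"
        have "k - 1 \<le> length p - i" using p(2) k i(1) by linarith
        then have ls: "length s = k - 1" by (simp add: s_def)
        have "set s \<subseteq> set p"
          unfolding s_def using set_take_subset set_drop_subset by (rule order_trans)
        moreover have "adjs p \<subseteq> E3" using p(1) 2(3) 3 unfolding is_path_def by blast
        ultimately have s: "distinct s" "set s \<subseteq> A" "adjs s \<subseteq> E3"
          using dp p(3) adjs_sublist[of "k - 1" i p] by (simp_all add: s_def)
        have "s \<noteq> []" using ls k by auto
        moreover have "hd s = p ! i" using k p(2) i by (simp add: s_def hd_conv_nth)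
        moreover have "last s = p ! (i + k - 2)"
        proof -
          have "last s = take (k - 1) (drop i p) ! (k - 1 - 1)"
            using ls \<open>s \<noteq> []\<close> by (simp add: last_conv_nth) (simp add: s_def)
          also have "\<dots> = drop i p ! (k - 1 - 1)" using k by (intro nth_take) linarith
          also have "\<dots> = p ! (i + (k - 1 - 1))" using p(2) i(1) by (intro nth_drop) simp
          also have "i + (k - 1 - 1) = i + k - 2" using k by simp
          finally show ?thesis .
        qed
        ultimately have "cyc_edges (ts ! i # s) \<subseteq> E3"
          using s(3) i matched[OF i(1)] 3 by (auto simp: cyc_edges_def adjs_Cons insert_commute)
        moreover have "distinct (ts ! i # s)" "set (ts ! i # s) \<subseteq> A \<union> B"
          using s tsB[OF i(1)] assms(3) by auto
        moreover have "length (ts ! i # s) = k" using ls k by simp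
        ultimately show "has_cycle_within E3 (A \<union> B) k"
          using k unfolding has_cycle_within_def cycle_on_def
          by (metis distinct_card)
      qed
      moreover have "length [3..<K + 1] = K - 2" unfolding length_upt by simp
      ultimately show "force q (K - 2) ?G U2 E2" by (simp only:)
    qed
  qed
qed

section \<open>Forcing an expander\<close>

definition dense_between :: "'a set set \<Rightarrow> nat \<Rightarrow> 'a set \<Rightarrow> 'a set \<Rightarrow> bool" where
  "dense_between E m L R \<longleftrightarrow>
     (\<forall>A\<subseteq>L. \<forall>B\<subseteq>R. m \<le> card A \<and> m \<le> card B \<longrightarrow> (\<exists>a\<in>A. \<exists>b\<in>B. {a, b} \<in> E))"

abbreviation edges_between :: "'a set \<Rightarrow> 'a set \<Rightarrow> 'a set set" where
  "edges_between A B \<equiv> (\<lambda>(a, b). {a, b}) ` (A \<times> B)"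

lemma card_edges_between:
  assumes "A \<inter> B = {}"
  shows "card (edges_between A B) = card A * card B"
proof -
  have "inj_on (\<lambda>(a, b). {a, b}) (A \<times> B)"
    using assms by (auto simp: inj_on_def doubleton_eq_iff)
  then show ?thesis by (simp add: card_image card_cartesian_product)
qed

text \<open>It suffices to hit the complete bipartite graphs with both sides of size exactly
  \<open>m\<close>. Each is determined by the union of its sides, so there are at most
  \<open>2 ^ card (L \<union> R)\<close> of them. The number \<open>w\<close> accounts for edges of
  \<open>H\<close> claimed earlier.\<close>

lemma force_dense:
  fixes \<beta> :: real
  assumes "finite L" "finite R" "L \<inter> R = {}" "0 \<le> \<beta>" "\<beta> \<le> 1"
    and H: "H = edges_between L R"
    and used: "card (H - U) \<le> w"
    and size: "real (q + 1) + \<beta> * (card L * card R) + real (r * (q + 1)) + w \<le> real (m * m)"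
    and few: "2 ^ card (L \<union> R) * (1 - \<beta>) ^ r < 1"
  shows "force q r (\<lambda>U' E'. dense_between E' m L R) (U \<inter> H) E"
proof -
  define \<F> where "\<F> = {edges_between A B |A B. A \<subseteq> L \<and> B \<subseteq> R \<and> card A = m \<and> card B = m}"
  have finH: "finite H" using assms(1,2) by (simp add: H)
  have \<F>_sub: "\<F> \<subseteq> (\<lambda>S. edges_between (S \<inter> L) (S \<inter> R)) ` Pow (L \<union> R)"
  proof
    fix Z assume "Z \<in> \<F>"
    then obtain A B where Z: "Z = edges_between A B" "A \<subseteq> L" "B \<subseteq> R" by (auto simp: \<F>_def)
    then have "(A \<union> B) \<inter> L = A" "(A \<union> B) \<inter> R = B" using assms(3) by auto
    then have "Z = (\<lambda>S. edges_between (S \<inter> L) (S \<inter> R)) (A \<union> B)" using Z by simp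
    then show "Z \<in> (\<lambda>S. edges_between (S \<inter> L) (S \<inter> R)) ` Pow (L \<union> R)"
      by (rule image_eqI) (use Z(2,3) in auto)
  qed
  then have fin\<F>: "finite \<F>" by (rule finite_subset) (use assms(1,2) in simp)
  have "card \<F> \<le> card ((\<lambda>S. edges_between (S \<inter> L) (S \<inter> R)) ` Pow (L \<union> R))"
    using \<F>_sub assms(1,2) by (intro card_mono) auto
  also have "\<dots> \<le> card (Pow (L \<union> R))" using assms(1,2) by (intro card_image_le) auto
  also have "\<dots> = 2 ^ card (L \<union> R)" using assms(1,2) by (simp add: card_Pow)
  finally have card\<F>: "card \<F> \<le> 2 ^ card (L \<union> R)" .
  have "force q r (\<lambda>U' E'. \<forall>A\<in>\<F>. A \<inter> E' \<noteq> {}) (U \<inter> H) E"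
  proof (rule force_hitting[OF fin\<F> finH _ _ assms(4,5)])
    show "A \<subseteq> H" if "A \<in> \<F>" for A using that unfolding \<F>_def H by auto
    show "real (q + 1) + \<beta> * card H + real (r * (q + 1)) \<le> real (card (Z \<inter> (U \<inter> H)))" if ZF: "Z \<in> \<F>" for Z
    proof -
      obtain A B where Z: "Z = edges_between A B" "A \<subseteq> L" "B \<subseteq> R" "card A = m" "card B = m"
        using ZF by (auto simp: \<F>_def)
      then have "A \<inter> B = {}" using assms(3) by blast
      then have "m * m = card Z" using Z card_edges_between[of A B] by simp
      have "Z \<subseteq> H" using Z by (auto simp: H)
      then have "Z \<subseteq> (Z \<inter> (U \<inter> H)) \<union> (H - U)" by blast
      then have "card Z \<le> card ((Z \<inter> (U \<inter> H)) \<union> (H - U))" using finH by (intro card_mono) auto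
      also have "\<dots> \<le> card (Z \<inter> (U \<inter> H)) + card (H - U)" by (rule card_Un_le)
      finally have "real (m * m) \<le> real (card (Z \<inter> (U \<inter> H))) + real w"
        using \<open>m * m = card Z\<close> used by linarith
      moreover have "card H = card L * card R" using card_edges_between[OF assms(3)] H by simp
      ultimately show ?thesis using size by simp
    qed
    have "card {A \<in> \<F>. A \<inter> E = {}} \<le> card \<F>" using fin\<F> by (intro card_mono) auto
    then have "real (card {A \<in> \<F>. A \<inter> E = {}}) \<le> real (2 ^ card (L \<union> R))" using card\<F> by linarith
    then have "real (card {A \<in> \<F>. A \<inter> E = {}}) * (1 - \<beta>) ^ r \<le> 2 ^ card (L \<union> R) * (1 - \<beta>) ^ r"
      using assms(5) by (intro mult_right_mono) auto
    then show "real (card {A \<in> \<F>. A \<inter> E = {}}) * (1 - \<beta>) ^ r < 1" using few by linarith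
  qed simp
  then show ?thesis
  proof (rule force_mono)
    fix U' E' assume hit: "\<forall>A\<in>\<F>. A \<inter> E' \<noteq> {}"
    show "dense_between E' m L R"
      unfolding dense_between_def
    proof (intro allI impI)
      fix A B assume AB: "A \<subseteq> L" "B \<subseteq> R" "m \<le> card A \<and> m \<le> card B"
      obtain A' where A': "A' \<subseteq> A" "card A' = m" using AB(3) obtain_subset_with_card_n by metis
      obtain B' where B': "B' \<subseteq> B" "card B' = m" using AB(3) obtain_subset_with_card_n by metis
      have "edges_between A' B' \<in> \<F>" unfolding \<F>_def using A' B' AB by blast
      then have "edges_between A' B' \<inter> E' \<noteq> {}" using hit by blast
      then show "\<exists>a\<in>A. \<exists>b\<in>B. {a, b} \<in> E'" using A' B' by auto
    qed
  qed
qed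

lemma dense_between_mono: "dense_between E m L R \<Longrightarrow> E \<subseteq> E' \<Longrightarrow> dense_between E' m L R"
  unfolding dense_between_def by blast

lemma dense_betweenD:
  "dense_between E m L R \<Longrightarrow> A \<subseteq> L \<Longrightarrow> B \<subseteq> R \<Longrightarrow> m \<le> card A \<Longrightarrow> m \<le> card B \<Longrightarrow>
   \<exists>a\<in>A. \<exists>b\<in>B. {a, b} \<in> E"
  unfolding dense_between_def by blast

text \<open>\<open>X\<close> is a largest set of fewer than \<open>2 * m\<close> vertices that fails to expand: together with a further
  non-expanding set \<open>S\<close> it would not expand either, which density excludes for sets of size at
  least \<open>2 * m\<close>.\<close>

lemma exceptional_set:
  assumes dense: "dense_between E m (V - Q1) Q1"
    and fin: "finite V" and Q: "Q1 \<subseteq> V" "Q2 \<subseteq> V" "Q1 \<inter> Q2 = {}"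
    and card: "30 * m \<le> card Q1" "30 * m \<le> card Q2" and m: "0 < m"
  obtains X where "X \<subseteq> V" "card X < 2 * m"
    "\<And>S. S \<subseteq> V - X \<Longrightarrow> card S \<le> 2 * m \<Longrightarrow>
       5 * card S \<le> card {v \<in> Q1 \<union> Q2 - (X \<union> S). \<exists>s\<in>S. {v, s} \<in> E}"
proof -
  define N where "N = (\<lambda>X. {v \<in> Q1 \<union> Q2 - X. \<exists>s\<in>X. {v, s} \<in> E})"
  define \<X> where "\<X> = {X. X \<subseteq> V \<and> card X < 2 * m \<and> card (N X) \<le> 5 * card X}"
  have finQ: "finite Q1" "finite Q2" using fin Q finite_subset by blast+
  have finN: "finite (N X)" for X using finQ by (simp add: N_def)
  have "{} \<in> \<X>" using m by (simp add: \<X>_def N_def)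
  moreover have "\<forall>Y. Y \<in> \<X> \<longrightarrow> card Y < 2 * m" by (simp add: \<X>_def)
  ultimately have "\<exists>X. X \<in> \<X> \<and> (\<forall>Y. Y \<in> \<X> \<longrightarrow> card Y \<le> card X)" by (rule ex_has_greatest_nat)
  then obtain X where X: "X \<in> \<X>" and max: "\<And>Y. Y \<in> \<X> \<Longrightarrow> card Y \<le> card X" by blast
  show thesis
  proof (rule that[of X])
    show "X \<subseteq> V" "card X < 2 * m" using X by (auto simp: \<X>_def)
    fix S assume S: "S \<subseteq> V - X" "card S \<le> 2 * m"
    show "5 * card S \<le> card {v \<in> Q1 \<union> Q2 - (X \<union> S). \<exists>s\<in>S. {v, s} \<in> E}"
    proof (rule ccontr)
      assume "\<not> ?thesis"
      then have less: "card {v \<in> Q1 \<union> Q2 - (X \<union> S). \<exists>s\<in>S. {v, s} \<in> E} < 5 * card S" by simp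
      let ?W = "X \<union> S"
      have finX: "finite X" "finite S" using X S fin by (auto simp: \<X>_def intro: finite_subset)
      have cW: "card ?W = card X + card S" using S finX by (intro card_Un_disjoint) auto
      have "N ?W \<subseteq> N X \<union> {v \<in> Q1 \<union> Q2 - (X \<union> S). \<exists>s\<in>S. {v, s} \<in> E}" by (auto simp: N_def)
      then have "card (N ?W) \<le> card (N X \<union> {v \<in> Q1 \<union> Q2 - (X \<union> S). \<exists>s\<in>S. {v, s} \<in> E})"
        using finN finQ by (intro card_mono) auto
      also have "\<dots> \<le> card (N X) + card {v \<in> Q1 \<union> Q2 - (X \<union> S). \<exists>s\<in>S. {v, s} \<in> E}" by (rule card_Un_le)
      finally have cN: "card (N ?W) \<le> 5 * card ?W" using less X cW by (simp add: \<X>_def)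
      have "?W \<subseteq> V" using X S by (auto simp: \<X>_def)
      have "\<not> card ?W < 2 * m"
      proof
        assume "card ?W < 2 * m"
        then have "?W \<in> \<X>" using cN \<open>?W \<subseteq> V\<close> by (simp add: \<X>_def)
        then show False using max[of ?W] cW less by simp
      qed
      moreover have small: "card ?W \<le> 4 * m" using cW S X by (simp add: \<X>_def)
      moreover have "card ?W = card (?W \<inter> Q1) + card (?W - Q1)"
        using finX card_Int_Diff[of ?W Q1] by simp
      \<comment> \<open>Density is known only across the boundary of \<open>Q1\<close>. Thus
        vertices of \<open>?W\<close> in \<open>Q1\<close> are tested against \<open>Q2\<close>, and
        the others against \<open>Q1\<close>.\<close>
      ultimately consider "m \<le> card (?W \<inter> Q1)" | "m \<le> card (?W - Q1)" by linarith
      \<comment> \<open>\<open>?W\<close> and its neighbours occupy at most 4m + 5 * 4m = 24m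
        vertices, so 30m leaves enough for a contradiction with density.\<close>
      moreover have big: "m \<le> card (P - (?W \<union> N ?W))" if "30 * m \<le> card P" "finite P" for P
      proof -
        have "card (?W \<union> N ?W) \<le> card ?W + card (N ?W)" by (rule card_Un_le)
        also have "\<dots> \<le> 24 * m" using small cN by simp
        finally have "card (?W \<union> N ?W) \<le> 24 * m" .
        moreover have "card P - card (?W \<union> N ?W) \<le> card (P - (?W \<union> N ?W))"
          by (rule diff_card_le_card_Diff) (use finX finN in simp)
        ultimately show ?thesis using that m by linarith
      qed
      ultimately show False
      proof cases
        case 1
        have "\<exists>a\<in>Q2 - (?W \<union> N ?W). \<exists>b\<in>?W \<inter> Q1. {a, b} \<in> E"
          by (rule dense_betweenD[OF dense]) (use 1 Q big[OF card(2) finQ(2)] in auto)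
        then show False by (auto simp: N_def)
      next
        case 2
        have "\<exists>a\<in>?W - Q1. \<exists>b\<in>Q1 - (?W \<union> N ?W). {a, b} \<in> E"
          by (rule dense_betweenD[OF dense]) (use 2 big[OF card(1) finQ(1)] \<open>?W \<subseteq> V\<close> in auto)
        then obtain a b where ab: "a \<in> ?W" "b \<in> Q1 - (?W \<union> N ?W)" "{b, a} \<in> E"
          by (auto simp: insert_commute)
        then have "b \<in> N ?W" unfolding N_def by blast
        then show False using ab(2) by blast
      qed
    qed
  qed
qed

text \<open>Since the sets range over \<open>V\<close> but only neighbours in \<open>Q\<close>
  count, one such statement gives expansion in every vertex set between \<open>Q\<close> and
  \<open>V\<close>, as the insertion of further vertices requires.\<close>

definition expands_into :: "'a set set \<Rightarrow> 'a set \<Rightarrow> 'a set \<Rightarrow> nat \<Rightarrow> bool" where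
  "expands_into E V Q k \<longleftrightarrow> (\<forall>S\<subseteq>V. S \<noteq> {} \<and> card S \<le> k \<longrightarrow>
     2 * card S < card {v \<in> Q - S. \<exists>s\<in>S. {v, s} \<in> E})"

lemma expands_into_mono:
  assumes "expands_into E V Q k" "E \<subseteq> E'" "finite Q"
  shows "expands_into E' V Q k"
  unfolding expands_into_def
proof (intro allI impI)
  fix S assume S: "S \<subseteq> V" "S \<noteq> {} \<and> card S \<le> k"
  have "card {v \<in> Q - S. \<exists>s\<in>S. {v, s} \<in> E} \<le> card {v \<in> Q - S. \<exists>s\<in>S. {v, s} \<in> E'}"
    by (rule card_mono) (use assms in auto)
  then show "2 * card S < card {v \<in> Q - S. \<exists>s\<in>S. {v, s} \<in> E'}"
    using assms(1) S unfolding expands_into_def by (meson less_le_trans)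
qed

lemma expands_into_expands:
  assumes "expands_into E V Q k" "Q \<subseteq> U" "U \<subseteq> V" "finite U"
  shows "expands E U k"
  unfolding expands_def
proof (intro allI impI)
  fix S assume S: "S \<subseteq> U" "S \<noteq> {} \<and> card S \<le> k"
  have "card {v \<in> Q - S. \<exists>s\<in>S. {v, s} \<in> E} \<le> card {v \<in> U - S. \<exists>s\<in>S. {v, s} \<in> E}"
    by (rule card_mono) (use assms in auto)
  then show "2 * card S < card {v \<in> U - S. \<exists>s\<in>S. {v, s} \<in> E}"
    using assms(1) S assms(3) unfolding expands_into_def by (meson less_le_trans order_trans)
qed

text \<open>Let a and b be the numbers of vertices of \<open>S\<close> inside and outside
  \<open>X\<close>. If a <= b, the outer part has at least 5b > 2(a + b) neighbours. If a > b, the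
  stars have 5a leaves outside \<open>X\<close>, at most b of them in \<open>S\<close>, and 5a - b >
  2(a + b) says exactly that a > b; hence the constant 5.\<close>

lemma expands_into_of_stars:
  assumes fin: "finite V" "finite Q" and X: "X \<subseteq> V"
    and out: "\<And>S. S \<subseteq> V - X \<Longrightarrow> card S \<le> k \<Longrightarrow>
       5 * card S \<le> card {v \<in> Q - (X \<union> S). \<exists>s\<in>S. {v, s} \<in> E}"
    and g: "\<And>x. x \<in> X \<Longrightarrow> g x \<subseteq> Q - X \<and> card (g x) = 5 \<and> (\<forall>t\<in>g x. {x, t} \<in> E)"
    and disj: "\<And>x y. x \<in> X \<Longrightarrow> y \<in> X \<Longrightarrow> x \<noteq> y \<Longrightarrow> g x \<inter> g y = {}"
  shows "expands_into E V Q k"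
  unfolding expands_into_def
proof (intro allI impI)
  fix S assume S: "S \<subseteq> V" "S \<noteq> {} \<and> card S \<le> k"
  let ?N = "{v \<in> Q - S. \<exists>s\<in>S. {v, s} \<in> E}" and ?A = "S \<inter> X" and ?B = "S - X"
  have finS: "finite S" using S fin finite_subset by blast
  have cS: "card S = card ?A + card ?B" using finS by (rule card_Int_Diff)
  have cpos: "card S > 0" using S finS by (simp add: card_gt_0_iff)
  have finN: "finite ?N" using fin by simp
  show "2 * card S < card ?N"
  proof (cases "card ?A \<le> card ?B")
    case True
    have "5 * card ?B \<le> card {v \<in> Q - (X \<union> ?B). \<exists>s\<in>?B. {v, s} \<in> E}"
      using S cS by (intro out) auto
    also have "\<dots> \<le> card ?N" by (rule card_mono[OF finN]) (use S in auto)
    finally show ?thesis using True cS cpos by linarith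
  next
    case False
    have finA: "finite ?A" using finS by simp
    have fing: "finite (g x)" if "x \<in> ?A" for x using g[of x] that fin(2) by (auto intro: finite_subset)
    have "(\<Union>x\<in>?A. g x) - ?B \<subseteq> ?N"
    proof
      fix t assume "t \<in> (\<Union>x\<in>?A. g x) - ?B"
      then obtain x where x: "x \<in> S" "x \<in> X" "t \<in> g x" "t \<notin> ?B" by auto
      then have "t \<in> Q - S" "{t, x} \<in> E" using g[OF x(2)] by (auto simp: insert_commute)
      then show "t \<in> ?N" using x by auto
    qed
    then have "card ((\<Union>x\<in>?A. g x) - ?B) \<le> card ?N" by (rule card_mono[OF finN])
    moreover have "card (\<Union>x\<in>?A. g x) = (\<Sum>x\<in>?A. card (g x))"
      by (rule card_UN_disjoint) (use finA fing disj in auto)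
    moreover have "(\<Sum>x\<in>?A. card (g x)) = 5 * card ?A" using g by simp
    moreover have "card (\<Union>x\<in>?A. g x) - card ?B \<le> card ((\<Union>x\<in>?A. g x) - ?B)"
      by (rule diff_card_le_card_Diff) (use finS in simp)
    ultimately show ?thesis using False cS by linarith
  qed
qed

text \<open>If \<open>C\<close> or its complement in Q has at most \<open>2 * m\<close> vertices,
  expansion provides the edge. Otherwise counting in \<open>Q1\<close> and \<open>Q2\<close> shows
  that one side has \<open>m\<close> vertices in \<open>Q1\<close> and the other has
  \<open>m\<close> in \<open>Q2\<close>, and density applies.\<close>

lemma expander_connected:
  assumes dense: "dense_between E m (V - Q1) Q1" and ex: "expands_into E V (Q1 \<union> Q2) (2 * m)"
    and Q: "Q1 \<subseteq> V" "Q2 \<subseteq> V" "Q1 \<inter> Q2 = {}" and fin: "finite V"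
    and card: "30 * m \<le> card Q1" "30 * m \<le> card Q2" and m: "0 < m"
    and C: "C \<subseteq> Q1 \<union> Q2" "C \<noteq> {}" "C \<noteq> Q1 \<union> Q2"
  shows "\<exists>c\<in>C. \<exists>v\<in>Q1 \<union> Q2 - C. {v, c} \<in> E"
proof -
  let ?D = "Q1 \<union> Q2 - C"
  have small: "\<exists>s\<in>S. \<exists>v\<in>Q1 \<union> Q2 - S. {v, s} \<in> E" if "S \<subseteq> Q1 \<union> Q2" "S \<noteq> {}" "card S \<le> 2 * m" for S
  proof -
    have "S \<subseteq> V" using that(1) Q by blast
    then have "0 < card {v \<in> Q1 \<union> Q2 - S. \<exists>s\<in>S. {v, s} \<in> E}"
      using ex[unfolded expands_into_def, rule_format, of S] that(2,3) by linarith
    then have "{v \<in> Q1 \<union> Q2 - S. \<exists>s\<in>S. {v, s} \<in> E} \<noteq> {}" by (simp only: card_gt_0_iff) simp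
    then show ?thesis by blast
  qed
  have finQ: "finite Q1" "finite Q2" using fin Q finite_subset by blast+
  have split: "card P = card (P \<inter> C) + card (P \<inter> ?D)" if "P = Q1 \<or> P = Q2" for P
  proof -
    have "P \<inter> ?D = P - C" using that by auto
    moreover have "finite P" using that finQ by auto
    ultimately show ?thesis using card_Int_Diff[of P C] by simp
  qed
  have parts: "card S = card (Q1 \<inter> S) + card (Q2 \<inter> S)" if "S \<subseteq> Q1 \<union> Q2" for S
  proof -
    have "S = (Q1 \<inter> S) \<union> (Q2 \<inter> S)" using that by blast
    moreover have "card ((Q1 \<inter> S) \<union> (Q2 \<inter> S)) = card (Q1 \<inter> S) + card (Q2 \<inter> S)"
      using finQ Q(3) by (intro card_Un_disjoint) auto
    ultimately show ?thesis by simp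
  qed
  have "card Q1 = card (Q1 \<inter> C) + card (Q1 \<inter> ?D)" "card Q2 = card (Q2 \<inter> C) + card (Q2 \<inter> ?D)"
    using split by blast+
  moreover have "card C = card (Q1 \<inter> C) + card (Q2 \<inter> C)" using parts[OF C(1)] .
  moreover have "card ?D = card (Q1 \<inter> ?D) + card (Q2 \<inter> ?D)" by (rule parts) blast
  ultimately have "card C \<le> 2 * m \<or> card ?D \<le> 2 * m
      \<or> m \<le> card (Q1 \<inter> C) \<and> m \<le> card (Q2 \<inter> ?D) \<or> m \<le> card (Q1 \<inter> ?D) \<and> m \<le> card (Q2 \<inter> C)"
    using card m by linarith
  then consider "card C \<le> 2 * m" | "card ?D \<le> 2 * m"
    | "m \<le> card (Q1 \<inter> C)" "m \<le> card (Q2 \<inter> ?D)" | "m \<le> card (Q1 \<inter> ?D)" "m \<le> card (Q2 \<inter> C)"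
    by blast
  then show ?thesis
  proof cases
    case 1
    then show ?thesis using small[OF C(1,2)] by simp
  next
    case 2
    have "?D \<noteq> {}" using C by blast
    then obtain s v where "s \<in> ?D" "v \<in> Q1 \<union> Q2 - ?D" "{v, s} \<in> E" using small[of ?D] 2 by blast
    moreover have "{s, v} \<in> E" using \<open>{v, s} \<in> E\<close> by (metis insert_commute)
    ultimately show ?thesis by blast
  next
    case 3
    have "\<exists>a\<in>Q2 \<inter> ?D. \<exists>b\<in>Q1 \<inter> C. {a, b} \<in> E"
      by (rule dense_betweenD[OF dense]) (use 3 Q in auto)
    then show ?thesis by blast
  next
    case 4
    have "\<exists>a\<in>Q2 \<inter> C. \<exists>b\<in>Q1 \<inter> ?D. {a, b} \<in> E"
      by (rule dense_betweenD[OF dense]) (use 4 Q in auto)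
    then obtain a b where "a \<in> C" "b \<in> ?D" "{a, b} \<in> E" by blast
    moreover have "{b, a} \<in> E" using \<open>{a, b} \<in> E\<close> by (metis insert_commute)
    ultimately show ?thesis by blast
  qed
qed

lemma force_le: "force q r G U E \<Longrightarrow> r \<le> s \<Longrightarrow> force q s G U E"
  using force_bind[of q r G U E "s - r" G] force_now by fastforce

lemma card_used_step:
  assumes "U' \<subseteq> U" "finite P" "U \<subseteq> P"
  shows "card (P - U') \<le> card (P - U) + card (U - U')"
proof -
  have "P - U' = (P - U) \<union> (U - U')" using assms by blast
  then show ?thesis by (simp add: card_Un_le)
qed

text \<open>For M = 96000, (1 - 1/M)^M <= 1/e < 1/2, so M rounds per vertex beat the factor 2 per
  vertex in the number of targets.\<close>

lemma two_power_times_small: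
  fixes n :: nat
  assumes "n > 0"
  shows "2 ^ n * (1 - 1 / 96000 :: real) ^ (96000 * n) < 1"
proof -
  have "(1 - 1 / 96000 :: real) \<le> exp (- 1 / 96000)"
    using exp_ge_add_one_self[of "- 1 / 96000 :: real"] by simp
  then have "(1 - 1 / 96000 :: real) ^ 96000 \<le> exp (- 1 / 96000) ^ 96000"
    by (rule power_mono) simp
  also have "\<dots> = exp (- 1)" by (simp flip: exp_of_nat_mult)
  also have "\<dots> < 1 / 2"
  proof -
    have "3 / 2 \<le> exp (1 / 2 :: real)" using exp_ge_add_one_self[of "1 / 2 :: real"] by simp
    then have "3 / 2 * (3 / 2) \<le> exp (1 / 2 :: real) * exp (1 / 2)" by (intro mult_mono) auto
    also have "\<dots> = exp (1 :: real)" by (simp flip: exp_add)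
    finally have "2 < exp (1 :: real)" by simp
    then show ?thesis by (simp add: exp_minus field_simps)
  qed
  finally have "2 * (1 - 1 / 96000 :: real) ^ 96000 < 1" by linarith
  moreover have "0 \<le> 2 * (1 - 1 / 96000 :: real) ^ 96000" by simp
  ultimately have "(2 * (1 - 1 / 96000 :: real) ^ 96000) ^ n < 1"
    using assms by (intro power_less_one_iff[THEN iffD2]) auto
  then show ?thesis by (simp only: power_mult_distrib power_mult)
qed

text \<open>Density is forced with the edges between \<open>Q1\<close> and its complement only, so that the edges needed for the
  stars, from \<open>X \<inter> Q1\<close> into \<open>Q1\<close> and from \<open>X - Q1\<close> into \<open>Q2\<close>, are still unclaimed.\<close>

lemma force_expander:
  assumes fin: "finite V" and Q: "Q1 \<subseteq> V" "Q2 \<subseteq> V" "Q1 \<inter> Q2 = {}"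
    and card: "card Q1 = 30 * m" "card Q2 = 30 * m" and n: "card V \<le> 400 * m" and m: "0 < m"
    and q: "(q + 1) * 100000000 \<le> m"
    and U: "finite U" "card (edges_between (V - Q1) Q1 - U) \<le> 200 * m * (q + 1)"
    and fresh: "\<And>a b. a \<in> V \<Longrightarrow> b \<in> Q1 \<union> Q2 \<Longrightarrow> a \<noteq> b \<Longrightarrow> {a, b} \<in> U"
  shows "force q (96000 * card V + (10 * m + 10 * m))
     (\<lambda>U' E'. dense_between E' m (V - Q1) Q1 \<and> expands_into E' V (Q1 \<union> Q2) (2 * m)) U E"
proof -
  let ?G = "\<lambda>U' E'. dense_between E' m (V - Q1) Q1 \<and> expands_into E' V (Q1 \<union> Q2) (2 * m)"
  have finQ: "finite Q1" "finite Q2" using fin Q finite_subset by blast+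
  define H1 where "H1 = edges_between (V - Q1) Q1"
  have H1U: "H1 \<subseteq> U" unfolding H1_def using fresh by auto
  have VQ: "(V - Q1) \<union> Q1 = V" using Q by blast
  have "V \<noteq> {}" using card m Q(1) by auto
  then have npos: "0 < card V" using fin by (simp add: card_gt_0_iff)
  have "force q (96000 * card V) (\<lambda>U' E'. dense_between E' m (V - Q1) Q1) (U \<inter> H1) E"
  proof (rule force_dense[where \<beta> = "1 / 96000" and w = "200 * m * (q + 1)"])
    \<comment> \<open>The board has at most 400m * 30m = 12000 m^2 edges, so \<beta> = 1/96000 makes
      its term at most m^2 / 8. The other terms sum to less than 4 * 10^7 m (q + 1), which is at
      most 0.4 m^2.\<close>
    show "real (q + 1) + 1 / 96000 * (card (V - Q1) * card Q1) + real (96000 * card V * (q + 1)) +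
        real (200 * m * (q + 1)) \<le> real (m * m)"
    proof -
      have "card (V - Q1) \<le> 400 * m" using n card_mono[OF fin, of "V - Q1"] by auto
      then have 1: "card (V - Q1) * card Q1 \<le> 400 * m * (30 * m)" unfolding card(1) by (rule mult_right_mono) simp
      have 2: "96000 * card V * (q + 1) \<le> 96000 * (400 * m) * (q + 1)" using n by (intro mult_right_mono) auto
      have 3: "m * ((q + 1) * 100000000) \<le> m * m" using q by (rule mult_left_mono) simp
      have 4: "q + 1 \<le> m * (q + 1)" using mult_le_mono1[of 1 m "q + 1"] m by simp
      have b1: "real (card (V - Q1) * card Q1) \<le> 12000 * real (m * m)"
        using of_nat_mono[OF 1, where 'a = real] by simp
      have b2: "real (96000 * card V * (q + 1)) \<le> 38400000 * real (m * (q + 1))"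
        using of_nat_mono[OF 2, where 'a = real] by (simp add: algebra_simps)
      have b3: "100000000 * real (m * (q + 1)) \<le> real (m * m)"
        using of_nat_mono[OF 3, where 'a = real] by (simp add: algebra_simps)
      have b4: "real (q + 1) \<le> real (m * (q + 1))" using 4 of_nat_mono by blast
      have b5: "real (200 * m * (q + 1)) = 200 * real (m * (q + 1))" by simp
      show ?thesis using b1 b2 b3 b4 unfolding b5 by linarith
    qed
    show "2 ^ card (V - Q1 \<union> Q1) * (1 - 1 / 96000) ^ (96000 * card V) < (1 :: real)"
      unfolding VQ using npos by (rule two_power_times_small)
  qed (use fin finQ U in \<open>auto simp: H1_def\<close>)
  then have dense: "force q (96000 * card V) (\<lambda>U' E'. dense_between E' m (V - Q1) Q1) H1 E"
    using H1U by (simp add: Int_absorb1)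
  show ?thesis
  proof (rule force_compose[OF dense H1U U(1)])
    fix U1 E1
    assume U1: "U - H1 \<subseteq> U1" "U1 \<subseteq> U" and dense1: "dense_between E1 m (V - Q1) Q1"
    obtain X where X: "X \<subseteq> V" "card X < 2 * m"
      and out: "\<And>S. S \<subseteq> V - X \<Longrightarrow> card S \<le> 2 * m \<Longrightarrow>
       5 * card S \<le> card {v \<in> Q1 \<union> Q2 - (X \<union> S). \<exists>s\<in>S. {v, s} \<in> E1}"
      by (rule exceptional_set[OF dense1 fin Q _ _ m]) (use card in auto)
    have finX: "finite X" using X fin finite_subset by blast
    obtain xs1 where xs1: "set xs1 = X \<inter> Q1" "distinct xs1" using finite_distinct_list[of "X \<inter> Q1"] finX by auto
    obtain xs2 where xs2: "set xs2 = X - Q1" "distinct xs2" using finite_distinct_list[of "X - Q1"] finX by auto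
    have len: "length xs1 \<le> 2 * m" "length xs2 \<le> 2 * m"
      using X(2) card_mono[OF finX, of "X \<inter> Q1"] card_mono[OF finX, of "X - Q1"]
        distinct_card[OF xs1(2)] distinct_card[OF xs2(2)] xs1(1) xs2(1) by auto
    have qm: "q \<le> m" using q by simp
    \<comment> \<open>The stars need at most 5 (2m + m) = 15m vertices, and more than 28m remain
      outside \<open>X\<close>.\<close>
    have room: "5 * (l + q) \<le> card (P - X)" if "l \<le> 2 * m" "card P = 30 * m" for l P
    proof -
      have "card P - card X \<le> card (P - X)" by (rule diff_card_le_card_Diff[OF finX])
      then have "5 * l + 5 * q \<le> card (P - X)" using that X(2) qm by linarith
      then show ?thesis by simp
    qed
    have finU1: "finite U1" using U1 U(1) finite_subset by blast
    let ?S = "\<lambda>xs T E'. \<exists>g.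
     (\<forall>x\<in>set xs. g x \<subseteq> T \<and> card (g x) = 5 \<and> (\<forall>t\<in>g x. {x, t} \<in> E')) \<and>
     (\<forall>x\<in>set xs. \<forall>y\<in>set xs. x \<noteq> y \<longrightarrow> g x \<inter> g y = {})"
    define H2 where "H2 = edges_between (X \<inter> Q1) (Q1 - X)"
    have H2: "H2 \<subseteq> U1"
    proof
      fix e assume "e \<in> H2"
      then obtain a b where ab: "e = {a, b}" "a \<in> X \<inter> Q1" "b \<in> Q1 - X" by (auto simp: H2_def)
      then have "e \<in> U" using fresh[of a b] X(1) by auto
      moreover have "e \<notin> H1" using ab by (auto simp: H1_def doubleton_eq_iff)
      ultimately show "e \<in> U1" using U1 by blast
    qed
    have "force q (5 * length xs1) (\<lambda>U' E'. ?S xs1 (Q1 - X) E') H2 E1"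
      by (rule force_stars) (use xs1 finX finQ room[OF len(1) card(1)] in \<open>auto simp: H2_def\<close>)
    then have stars1: "force q (10 * m) (\<lambda>U' E'. ?S xs1 (Q1 - X) E') H2 E1"
      by (rule force_le) (use len in simp)
    show "force q (10 * m + 10 * m) ?G U1 E1"
    proof (rule force_compose[OF stars1 H2 finU1])
      fix U2 E2
      assume U2: "U1 - H2 \<subseteq> U2" "U2 \<subseteq> U1" and E2: "E1 \<subseteq> E2" and S1: "?S xs1 (Q1 - X) E2"
      have finU2: "finite U2" using U2 finU1 finite_subset by blast
      have "force q (5 * length xs2) (\<lambda>U' E'. ?S xs2 (Q2 - X) E') U2 E2"
      proof (rule force_stars)
        fix x t assume x: "x \<in> set xs2" and t: "t \<in> Q2 - X"
        have "{x, t} \<in> U" using fresh[of x t] x t xs2 X(1) by auto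
        moreover have "{x, t} \<notin> H1" "{x, t} \<notin> H2"
          using x t xs2(1) Q(3) by (auto simp: H1_def H2_def doubleton_eq_iff)
        ultimately show "{x, t} \<in> U2" using U1 U2 by blast
      qed (use xs2 finX finQ finU2 room[OF len(2) card(2)] in auto)
      then have "force q (10 * m) (\<lambda>U' E'. ?S xs2 (Q2 - X) E') U2 E2"
        by (rule force_le) (use len in simp)
      from force_keep[OF this finU2] show "force q (10 * m) ?G U2 E2"
      proof (rule force_mono)
        fix U3 E3
        assume "U3 \<subseteq> U2 \<and> E2 \<subseteq> E3 \<and> card (U2 - U3) \<le> 10 * m * (q + 1) \<and> ?S xs2 (Q2 - X) E3"
        then have E3: "E2 \<subseteq> E3" and S2: "?S xs2 (Q2 - X) E3" by simp_all
        obtain g1 where g1: "\<forall>x\<in>set xs1. g1 x \<subseteq> Q1 - X \<and> card (g1 x) = 5 \<and> (\<forall>t\<in>g1 x. {x, t} \<in> E2)"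
          "\<forall>x\<in>set xs1. \<forall>y\<in>set xs1. x \<noteq> y \<longrightarrow> g1 x \<inter> g1 y = {}" using S1 by (elim exE conjE)
        obtain g2 where g2: "\<forall>x\<in>set xs2. g2 x \<subseteq> Q2 - X \<and> card (g2 x) = 5 \<and> (\<forall>t\<in>g2 x. {x, t} \<in> E3)"
          "\<forall>x\<in>set xs2. \<forall>y\<in>set xs2. x \<noteq> y \<longrightarrow> g2 x \<inter> g2 y = {}" using S2 by (elim exE conjE)
        define g where "g = (\<lambda>x. if x \<in> Q1 then g1 x else g2 x)"
        have "expands_into E3 V (Q1 \<union> Q2) (2 * m)"
        proof (rule expands_into_of_stars[OF fin _ X(1)])
          show "finite (Q1 \<union> Q2)" using finQ by simp
          show "g x \<subseteq> Q1 \<union> Q2 - X \<and> card (g x) = 5 \<and> (\<forall>t\<in>g x. {x, t} \<in> E3)" if "x \<in> X" for x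
          proof (cases "x \<in> Q1")
            case True
            then have "x \<in> set xs1" using that xs1 by simp
            then show ?thesis using g1(1) True E3 by (auto simp: g_def)
          next
            case False
            then have "x \<in> set xs2" using that xs2 by simp
            then show ?thesis using g2(1) False by (auto simp: g_def)
          qed
          show "g x \<inter> g y = {}" if "x \<in> X" "y \<in> X" "x \<noteq> y" for x y
          proof -
            have in1: "g z \<subseteq> Q1" if "z \<in> X" "z \<in> Q1" for z using that xs1 g1(1) by (auto simp: g_def)
            have in2: "g z \<subseteq> Q2" if "z \<in> X" "z \<notin> Q1" for z using that xs2 g2(1) by (auto simp: g_def)
            show ?thesis
            proof (cases "x \<in> Q1 \<longleftrightarrow> y \<in> Q1")
              case True
              then show ?thesis using that xs1(1) xs2(1) g1(2) g2(2) by (cases "x \<in> Q1") (auto simp: g_def)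
            next
              case False
              then show ?thesis using in1[of x] in1[of y] in2[of x] in2[of y] that Q(3) by blast
            qed
          qed
          show "5 * card S \<le> card {v \<in> Q1 \<union> Q2 - (X \<union> S). \<exists>s\<in>S. {v, s} \<in> E3}"
            if "S \<subseteq> V - X" "card S \<le> 2 * m" for S
          proof -
            have "card {v \<in> Q1 \<union> Q2 - (X \<union> S). \<exists>s\<in>S. {v, s} \<in> E1} \<le>
                card {v \<in> Q1 \<union> Q2 - (X \<union> S). \<exists>s\<in>S. {v, s} \<in> E3}"
              by (rule card_mono) (use finQ E2 E3 in auto)
            then show ?thesis using out[OF that] by linarith
          qed
        qed
        moreover have "dense_between E3 m (V - Q1) Q1"
          using dense1 by (rule dense_between_mono) (use E2 E3 in blast)
        ultimately show "?G U3 E3" by blast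
      qed
    qed
  qed
qed

section \<open>Forcing long cycles\<close>

text \<open>At least \<open>k * k / 2\<close> boosters exist, and at most
  \<open>card (P - U)\<close> of them have been claimed, so a full offer of boosters remains and
  every answer closes a cycle. \<open>C\<close> carries the path and \<open>C'\<close> is the region
  in which it cannot be extended; they differ while the Hamilton cycle is being built and agree
  during the insertions.\<close>

lemma offer_boosters:
  assumes "finite C" and ex: "expands E C' k" "C \<subseteq> C'" "finite C'" and start: "spans E C y0 z0"
    and stuck: "\<And>y z v. spans E C y z \<Longrightarrow> v \<in> C' \<Longrightarrow> {v, z} \<in> E \<Longrightarrow> v \<in> C"
    and P: "\<And>a b. a \<in> C \<Longrightarrow> b \<in> C \<Longrightarrow> a \<noteq> b \<Longrightarrow> {a, b} \<in> P"
    and finP: "finite P" and avail: "2 * (card (P - U) + q + 1) \<le> k * k" and k: "2 \<le> k"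
  obtains F where "F \<subseteq> U" "card F = q + 1" "\<And>e. e \<in> F \<Longrightarrow> cycle_on (insert e E) C"
proof -
  define B where "B = {{y, z} |y z. spans E C y z}"
  have cC: "k < card C"
    by (rule card_boosters(1)[OF ex(3,2,1) start]) (use stuck in blast)
  have cB: "k * k \<le> 2 * card B"
    unfolding B_def by (rule card_boosters(2)[OF ex(3,2,1) start]) (use stuck in blast)
  have "B \<subseteq> P"
  proof
    fix e assume "e \<in> B"
    then obtain y z where e: "e = {y, z}" "spans E C y z" unfolding B_def by blast
    then obtain p where p: "is_path E p" "set p = C" "hd p = y" "last p = z" by (auto simp: spans_def)
    have "distinct p" using p by (simp add: is_path_def)
    then have "length p > 1" using p(2) cC k by (metis distinct_card less_le_trans less_trans one_less_numeral_iff semiring_norm(76))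
    then have "hd p \<noteq> last p" using \<open>distinct p\<close> by (cases p) auto
    then show "e \<in> P" using P[of y z] e p spans_in[OF e(2)] by auto
  qed
  then have "B \<subseteq> (B \<inter> U) \<union> (P - U)" by blast
  then have "card B \<le> card ((B \<inter> U) \<union> (P - U))"
    using finP \<open>B \<subseteq> P\<close> by (intro card_mono) (auto intro: finite_subset)
  also have "\<dots> \<le> card (B \<inter> U) + card (P - U)" by (rule card_Un_le)
  finally have "card B \<le> card (B \<inter> U) + card (P - U)" .
  moreover have "2 * (card (P - U) + q + 1) \<le> 2 * card B" using avail cB by (rule le_trans)
  ultimately have "q + 1 \<le> card (B \<inter> U)" by simp
  then obtain F where F: "F \<subseteq> B \<inter> U" "card F = q + 1" by (rule obtain_subset_with_card_n)
  show thesis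
  proof (rule that[of F])
    show "F \<subseteq> U" "card F = q + 1" using F by auto
    fix e assume "e \<in> F"
    then obtain y z where "e = {y, z}" "spans E C y z" using F unfolding B_def by blast
    moreover have "3 \<le> card C" using cC k by linarith
    ultimately show "cycle_on (insert e E) C" using spans_close by metis
  qed
qed

text \<open>When a longest path in \<open>Q\<close> has been closed to a cycle that misses part of
  \<open>Q\<close>, an edge leaving the cycle gives a path with one more vertex. So \<open>d\<close>
  rounds suffice if \<open>card Q - card C\<close> of them lengthen the path and one more closes the
  Hamilton cycle; this is the \<open>+ 1\<close> in the hypothesis.\<close>

lemma force_hamiltonian:
  assumes Q: "finite Q" "Q \<subseteq> V" and k: "2 \<le> k" and finP: "finite P"
    and P: "\<And>a b. a \<in> Q \<Longrightarrow> b \<in> Q \<Longrightarrow> a \<noteq> b \<Longrightarrow> {a, b} \<in> P"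
    and "expands_into E V Q k"
    and "\<And>C. C \<subseteq> Q \<Longrightarrow> C \<noteq> {} \<Longrightarrow> C \<noteq> Q \<Longrightarrow> \<exists>c\<in>C. \<exists>v\<in>Q - C. {v, c} \<in> E"
    and "C \<subseteq> Q" "spans E C y z" "card Q + 1 \<le> card C + d"
    and "2 * (card (P - U) + d * (q + 1)) \<le> k * k"
  shows "force q d (\<lambda>U' E'. cycle_on E' Q) U E"
  using assms(6-)
proof (induction d arbitrary: C y z U E)
  case 0
  then show ?case using card_mono[OF Q(1) 0(3)] by simp
next
  case (Suc d C y z U E)
  let ?\<C> = "{C. C \<subseteq> Q \<and> (\<exists>y z. spans E C y z)}"
  have "C \<in> ?\<C>" using Suc.prems by blast
  moreover have "\<forall>Y. Y \<in> ?\<C> \<longrightarrow> card Y < Suc (card Q)"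
    using Q(1) by (auto simp: less_Suc_eq_le intro: card_mono)
  ultimately have "\<exists>M. M \<in> ?\<C> \<and> (\<forall>Y. Y \<in> ?\<C> \<longrightarrow> card Y \<le> card M)" by (rule ex_has_greatest_nat)
  then obtain M where M: "M \<in> ?\<C>" and max: "\<And>Y. Y \<in> ?\<C> \<Longrightarrow> card Y \<le> card M" by blast
  obtain y0 z0 where start: "spans E M y0 z0" using M by blast
  have MQ: "M \<subseteq> Q" using M by blast
  have finM: "finite M" using MQ Q(1) finite_subset by blast
  have stuck: "v \<in> M" if sp: "spans E M y z" and v: "v \<in> Q" "{v, z} \<in> E" for y z v
  proof (rule ccontr)
    assume "v \<notin> M"
    obtain p where p: "is_path E p" "set p = M" "hd p = z" "last p = y"
      using spans_sym[OF sp] by (auto simp: spans_def)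
    then have "is_path E (v # p)" using v \<open>v \<notin> M\<close> by (auto simp: is_path_def adjs_Cons)
    then have "spans E (insert v M) v y" unfolding spans_def using p
      by (intro exI[of _ "v # p"]) (auto simp: is_path_def)
    then have "card (insert v M) \<le> card M" using max[of "insert v M"] v MQ by blast
    then show False using \<open>v \<notin> M\<close> finM by simp
  qed
  have exQ: "expands E Q k" by (rule expands_into_expands[OF Suc.prems(1) order_refl Q(2,1)])
  have avail: "2 * (card (P - U) + q + 1) \<le> k * k" using Suc.prems(6) by simp
  obtain F where F: "F \<subseteq> U" "card F = q + 1" and cyc: "\<And>e. e \<in> F \<Longrightarrow> cycle_on (insert e E) M"
    by (rule offer_boosters[OF finM exQ MQ Q(1) start stuck _ finP avail k]) (use P MQ in auto)
  show ?case
  proof (rule force_step[OF F])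
    fix e assume e: "e \<in> F"
    show "force q d (\<lambda>U' E'. cycle_on E' Q) (U - F) (insert e E)"
    proof (cases "M = Q")
      case True
      then show ?thesis using cyc[OF e] by (intro force_now) simp
    next
      case False
      have "M \<noteq> {}" using spans_in[OF start] by blast
      then obtain c v where cv: "c \<in> M" "v \<in> Q - M" "{v, c} \<in> E" using Suc.prems(2)[OF MQ _ False] by blast
      obtain z1 where sp: "spans (insert e E) (insert v M) v z1"
        using cycle_on_extend[OF cyc[OF e] cv(1), of v] cv by auto
      show ?thesis
      proof (rule Suc.IH[OF _ _ _ sp])
        show "expands_into (insert e E) V Q k"
          by (rule expands_into_mono[OF Suc.prems(1)]) (use Q in auto)
        show "\<exists>c\<in>C. \<exists>v\<in>Q - C. {v, c} \<in> insert e E" if "C \<subseteq> Q" "C \<noteq> {}" "C \<noteq> Q" for C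
          using Suc.prems(2)[OF that] by blast
        show "insert v M \<subseteq> Q" using cv MQ by auto
        have "card C \<le> card M" using max[of C] Suc.prems by blast
        then show "card Q + 1 \<le> card (insert v M) + d" using Suc.prems(5) cv finM by simp
        have "P - (U - F) \<subseteq> (P - U) \<union> F" by blast
        then have "card (P - (U - F)) \<le> card ((P - U) \<union> F)"
          using finP F(2) by (intro card_mono) (auto intro: card_ge_0_finite)
        also have "\<dots> \<le> card (P - U) + card F" by (rule card_Un_le)
        finally have "card (P - (U - F)) \<le> card (P - U) + (q + 1)" using F(2) by simp
        then show "2 * (card (P - (U - F)) + d * (q + 1)) \<le> k * k" using Suc.prems(6) by simp
      qed
    qed
  qed
qed

text \<open>Expansion of the single set \<open>{y}\<close> gives \<open>y\<close> a neighbour on the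
  cycle; cutting the cycle there yields a path spanning \<open>insert y C\<close>. Boosters are
  sought with \<open>insert y C\<close> as the whole region, where no such path can be extended.
  Client's edges only accumulate, so the earlier cycles persist.\<close>

lemma force_insertions:
  assumes Q: "finite V" "Q \<subseteq> V" and k: "2 \<le> k" and finP: "finite P"
    and P: "\<And>a b. a \<in> V \<Longrightarrow> b \<in> V \<Longrightarrow> a \<noteq> b \<Longrightarrow> {a, b} \<in> P"
    and "expands_into E V Q k" "cycle_on E C" "Q \<subseteq> C" "C \<subseteq> V" "set ys \<subseteq> V" "C \<inter> set ys = {}" "distinct ys"
    and "2 * (card (P - U) + length ys * (q + 1)) \<le> k * k" "finite U"
  shows "force q (length ys) (\<lambda>U' E'. \<forall>i\<le>length ys. cycle_on E' (C \<union> set (take i ys))) U E"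
  using assms(6-)
proof (induction ys arbitrary: C U E)
  case (Cons y ys C U E)
  let ?C = "insert y C"
  have finC: "finite ?C" "?C \<subseteq> V" using Cons.prems Q finite_subset[of C V] by auto
  have y: "y \<in> V" "y \<notin> C" using Cons.prems by auto
  have "0 < card {v \<in> Q - {y}. {v, y} \<in> E}"
    using Cons.prems(1)[unfolded expands_into_def, rule_format, of "{y}"] y k by simp
  then have "{v \<in> Q - {y}. {v, y} \<in> E} \<noteq> {}" by (simp only: card_gt_0_iff) simp
  then obtain c where c: "c \<in> C" "{y, c} \<in> E" using Cons.prems(3) by (auto simp: insert_commute)
  obtain z where start: "spans E ?C y z" using cycle_on_extend[OF Cons.prems(2) c(1) y(2) c(2)] by blast
  have exC: "expands E ?C k"
    by (rule expands_into_expands[OF Cons.prems(1)]) (use Cons.prems finC in auto)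
  have avail: "2 * (card (P - U) + q + 1) \<le> k * k" using Cons.prems(8) by simp
  obtain F where F: "F \<subseteq> U" "card F = q + 1" and cyc: "\<And>e. e \<in> F \<Longrightarrow> cycle_on (insert e E) ?C"
    by (rule offer_boosters[OF finC(1) exC order_refl finC(1) start _ _ finP avail k]) (use P finC in auto)
  have "force q (Suc (length ys)) (\<lambda>U' E'. \<forall>i\<le>length (y # ys). cycle_on E' (C \<union> set (take i (y # ys)))) U E"
  proof (rule force_step[OF F])
    fix e assume e: "e \<in> F"
    have "force q (length ys) (\<lambda>U' E'. \<forall>i\<le>length ys. cycle_on E' (?C \<union> set (take i ys))) (U - F) (insert e E)"
    proof (rule Cons.IH)
      show "expands_into (insert e E) V Q k"
        by (rule expands_into_mono[OF Cons.prems(1)]) (use Q in \<open>auto intro: finite_subset\<close>)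
      have "P - (U - F) \<subseteq> (P - U) \<union> F" by blast
      then have "card (P - (U - F)) \<le> card ((P - U) \<union> F)"
        using finP F(2) by (intro card_mono) (auto intro: card_ge_0_finite)
      also have "\<dots> \<le> card (P - U) + card F" by (rule card_Un_le)
      finally have "card (P - (U - F)) \<le> card (P - U) + (q + 1)" using F(2) by simp
      then show "2 * (card (P - (U - F)) + length ys * (q + 1)) \<le> k * k" using Cons.prems(8) by simp
    qed (use Cons.prems cyc[OF e] finC in auto)
    moreover have "finite (U - F)" using Cons.prems(9) by simp
    ultimately have "force q (length ys) (\<lambda>U' E'. U' \<subseteq> U - F \<and> insert e E \<subseteq> E' \<and>
       card (U - F - U') \<le> length ys * (q + 1) \<and>
       (\<forall>i\<le>length ys. cycle_on E' (?C \<union> set (take i ys)))) (U - F) (insert e E)"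
      by (rule force_keep)
    then show "force q (length ys) (\<lambda>U' E'. \<forall>i\<le>length (y # ys). cycle_on E' (C \<union> set (take i (y # ys)))) (U - F) (insert e E)"
    proof (rule force_mono, intro allI impI)
      fix U' E' i
      assume *: "U' \<subseteq> U - F \<and> insert e E \<subseteq> E' \<and> card (U - F - U') \<le> length ys * (q + 1) \<and>
       (\<forall>i\<le>length ys. cycle_on E' (?C \<union> set (take i ys)))" and i: "i \<le> length (y # ys)"
      show "cycle_on E' (C \<union> set (take i (y # ys)))"
      proof (cases i)
        case 0
        then show ?thesis using cycle_on_mono[OF Cons.prems(2), of E'] * by auto
      next
        case (Suc i')
        then have "cycle_on E' (?C \<union> set (take i' ys))" using * i by simp
        then show ?thesis using Suc by simp
      qed
    qed
  qed
  then show ?case by simp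
next
  case Nil
  then show ?case by (intro force_now) simp
qed

lemma cycle_on_is_cycle:
  assumes "cycle_on E C" "C \<subseteq> V"
  shows "\<exists>vs. is_cycle (V, E) vs \<and> length vs = card C"
  using assms distinct_card by (fastforce simp: cycle_on_def is_cycle_iff)

lemma pancyclic_mono:
  assumes "pancyclic (V, E)" "E \<subseteq> E'"
  shows "pancyclic (V, E')"
  using assms by (fastforce simp: pancyclic_def is_cycle_iff)

lemma force_pancyclic:
  assumes q: "(q + 1) * 100000000 \<le> m" and n: "200 * m \<le> n" "n \<le> 400 * m"
  shows "\<exists>r. force q r (\<lambda>U E. pancyclic ({..<n}, E)) (complete_edges n) {}"
proof -
  let ?P = "complete_edges n" and ?V = "{..<n}"
  let ?G = "\<lambda>U E. pancyclic ({..<n}, E)"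
  \<comment> \<open>The size 30m comes from \<open>exceptional_set\<close>. Cycles up to length
    \<open>card ?Q\<close> = 60m must fit outside: \<open>A\<close> has to hold 60m + 2q + 1
    vertices and \<open>B\<close> has to hold 2q + 1, where q < m. All blocks together use 140m of
    the at least 200m vertices.\<close>
  define Q1 where "Q1 = {..<30 * m}"
  define Q2 where "Q2 = {30 * m..<60 * m}"
  define A where "A = {60 * m..<130 * m}"
  define B where "B = {130 * m..<140 * m}"
  let ?Q = "Q1 \<union> Q2"
  note defs = Q1_def Q2_def A_def B_def
  have Q_eq: "?Q = {..<60 * m}" by (auto simp: Q1_def Q2_def)
  have m: "0 < m" using q by (cases m) auto
  have qm: "q + 1 \<le> m" using q by simp
  have finP: "finite ?P" by (rule finite_complete_edges)
  have edge: "{a, b} \<in> ?P" if "a \<in> ?V" "b \<in> ?V" "a \<noteq> b" for a b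
    using that by (auto simp: complete_edges_def)
  define H0 where "H0 = {{a, b} |a b. a \<in> A \<union> B \<and> b \<in> A \<union> B \<and> a \<noteq> b}"
  have AB: "A \<union> B \<subseteq> ?V" using n by (auto simp: defs)
  have H0P: "H0 \<subseteq> ?P" using AB edge by (auto simp: H0_def)
  let ?short = "\<lambda>E. \<forall>k. 3 \<le> k \<and> k \<le> 60 * m \<longrightarrow> has_cycle_within E (A \<union> B) k"
  define r0 where "r0 = (60 * m + q) + ((q + 1) + (60 * m - 2))"
  define r1 where "r1 = 96000 * n + (10 * m + 10 * m)"
  define used where "used = (r0 + r1) * (q + 1)"
  have short: "force q r0 (\<lambda>U' E'. ?short E') H0 {}"
    unfolding r0_def
  proof (rule force_short_cycles)
    show "finite H0" using H0P finP finite_subset by blast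
  qed (use qm in \<open>auto simp: H0_def defs\<close>)
  have r0: "r0 \<le> 130 * m" using qm by (simp add: r0_def)
  \<comment> \<open>The edges offered in all rounds number at most m^2, whereas a path that cannot
    be extended has at least (2m)^2 / 2 = 2 m^2 boosters. The number of rounds is below 4 * 10^7 m,
    within the factor 10^8 of the hypothesis.\<close>
  have budget: "used + (60 * m + n) * (q + 1) \<le> m * m"
  proof -
    have "r0 + r1 + (60 * m + n) \<le> 100000000 * m" using r0 n by (simp add: r1_def)
    then have "(r0 + r1 + (60 * m + n)) * (q + 1) \<le> 100000000 * m * (q + 1)" by (rule mult_right_mono) simp
    also have "\<dots> = m * ((q + 1) * 100000000)" by (simp only: ac_simps)
    also have "\<dots> \<le> m * m" using q by (rule mult_left_mono) simp
    finally show ?thesis by (simp add: used_def algebra_simps)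
  qed
  have final: "force q (60 * m + (n - 60 * m)) ?G U E"
    if U: "U \<subseteq> ?P" "card (?P - U) \<le> used" and sh: "?short E"
      and dense: "dense_between E m (?V - Q1) Q1" and ex: "expands_into E ?V ?Q (2 * m)" for U E
  proof -
    have finU: "finite U" using U finP finite_subset by blast
    have QV: "?Q \<subseteq> ?V" using n by (auto simp: Q_eq)
    have "force q (60 * m) (\<lambda>U' E'. cycle_on E' ?Q) U E"
    proof (rule force_hamiltonian[where P = ?P and V = ?V and k = "2 * m" and C = "{0}" and y = 0 and z = 0])
      show "\<exists>c\<in>C. \<exists>v\<in>?Q - C. {v, c} \<in> E" if "C \<subseteq> ?Q" "C \<noteq> {}" "C \<noteq> ?Q" for C
        by (rule expander_connected[OF dense ex _ _ _ _ _ _ m that]) (use n in \<open>auto simp: defs\<close>)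
      show "spans E {0} 0 0" unfolding spans_def by (intro exI[of _ "[0]"]) (simp add: is_path_def)
      show "2 * (card (?P - U) + 60 * m * (q + 1)) \<le> 2 * m * (2 * m)"
        using U(2) budget by (simp add: algebra_simps)
    qed (use QV edge finP ex m in \<open>auto simp: Q_eq\<close>)
    then show ?thesis
    proof (rule force_compose[OF _ order_refl finU])
      fix U1 E1
      assume 1: "U1 \<subseteq> U" "E \<subseteq> E1" "card (U - U1) \<le> 60 * m * (q + 1)" and cyc: "cycle_on E1 ?Q"
      have finU1: "finite U1" using 1 finU finite_subset by blast
      let ?ys = "[60 * m..<n]"
      have "force q (length ?ys) (\<lambda>U' E'. \<forall>i\<le>length ?ys. cycle_on E' (?Q \<union> set (take i ?ys))) U1 E1"
      proof (rule force_insertions[where P = ?P and V = ?V and k = "2 * m" and Q = ?Q])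
        show "expands_into E1 ?V ?Q (2 * m)"
          by (rule expands_into_mono[OF ex 1(2)]) (simp add: Q_eq)
        have "card (?P - U1) \<le> card (?P - U) + card (U - U1)" by (rule card_used_step[OF 1(1) finP U(1)])
        then show "2 * (card (?P - U1) + length ?ys * (q + 1)) \<le> 2 * m * (2 * m)"
          using U(2) 1(3) budget n by (simp add: algebra_simps diff_mult_distrib)
      qed (use QV edge finP m cyc finU1 n in \<open>auto simp: Q_eq\<close>)
      from force_keep[OF this finU1] have "force q (length ?ys) ?G U1 E1"
      proof (rule force_mono)
        fix U2 E2
        assume "U2 \<subseteq> U1 \<and> E1 \<subseteq> E2 \<and> card (U1 - U2) \<le> length ?ys * (q + 1) \<and>
          (\<forall>i\<le>length ?ys. cycle_on E2 (?Q \<union> set (take i ?ys)))"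
        then have E2: "E1 \<subseteq> E2" and cycs: "\<And>i. i \<le> length ?ys \<Longrightarrow> cycle_on E2 (?Q \<union> set (take i ?ys))"
          by blast+
        show "pancyclic (?V, E2)"
          unfolding pancyclic_def
        proof (intro allI impI)
          fix k assume "3 \<le> k \<and> k \<le> card (fst (?V, E2))"
          then have k: "3 \<le> k" "k \<le> n" by auto
          show "\<exists>vs. is_cycle (?V, E2) vs \<and> length vs = k"
          proof (cases "k \<le> 60 * m")
            case True
            then obtain C where C: "C \<subseteq> A \<union> B" "card C = k" "cycle_on E C"
              using sh k(1) unfolding has_cycle_within_def by blast
            have "cycle_on E2 C" using C(3) by (rule cycle_on_mono) (use 1(2) E2 in blast)
            then show ?thesis using cycle_on_is_cycle[of E2 C ?V] C AB by auto
          next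
            case False
            have "set (take (k - 60 * m) ?ys) = {60 * m..<k}" using False k by (simp add: take_upt)
            then have "?Q \<union> set (take (k - 60 * m) ?ys) = {..<k}" using False by (auto simp: Q_eq)
            then have "cycle_on E2 {..<k}" using cycs[of "k - 60 * m"] k by simp
            then show ?thesis using cycle_on_is_cycle[of E2 "{..<k}" ?V] k by auto
          qed
        qed
      qed
      then show "force q (n - 60 * m) ?G U1 E1" by simp
    qed
  qed
  have "force q (r0 + (r1 + (60 * m + (n - 60 * m)))) ?G ?P {}"
  proof (rule force_compose[OF short H0P finP])
    fix U1 E1
    assume 1: "?P - H0 \<subseteq> U1" "U1 \<subseteq> ?P" "card (?P - U1) \<le> r0 * (q + 1)" and sh: "?short E1"
    have finU1: "finite U1" using 1 finP finite_subset by blast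
    have "force q r1 (\<lambda>U' E'. dense_between E' m (?V - Q1) Q1 \<and> expands_into E' ?V ?Q (2 * m)) U1 E1"
      unfolding r1_def
    proof -
      have "force q (96000 * card ?V + (10 * m + 10 * m))
        (\<lambda>U' E'. dense_between E' m (?V - Q1) Q1 \<and> expands_into E' ?V ?Q (2 * m)) U1 E1"
      proof (rule force_expander[OF _ _ _ _ _ _ _ m q finU1])
        show "{a, b} \<in> U1" if "a \<in> ?V" "b \<in> ?Q" "a \<noteq> b" for a b
        proof -
          have "{a, b} \<in> ?P" using that n by (intro edge) (auto simp: Q_eq)
          moreover have "{a, b} \<notin> H0"
            using that(2) unfolding Q_eq by (auto simp: H0_def A_def B_def doubleton_eq_iff)
          ultimately show ?thesis using 1(1) by blast
        qed
        have "edges_between (?V - Q1) Q1 \<subseteq> ?P" using n by (auto simp: Q1_def complete_edges_def)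
        then have "card (edges_between (?V - Q1) Q1 - U1) \<le> card (?P - U1)"
          using finP by (intro card_mono) auto
        also have "\<dots> \<le> r0 * (q + 1)" by (rule 1(3))
        also have "\<dots> \<le> 200 * m * (q + 1)" using r0 by (intro mult_right_mono) auto
        finally show "card (edges_between (?V - Q1) Q1 - U1) \<le> 200 * m * (q + 1)" .
      qed (use n in \<open>auto simp: defs\<close>)
      then show "force q (96000 * n + (10 * m + 10 * m))
        (\<lambda>U' E'. dense_between E' m (?V - Q1) Q1 \<and> expands_into E' ?V ?Q (2 * m)) U1 E1" by simp
    qed
    then show "force q (r1 + (60 * m + (n - 60 * m))) ?G U1 E1"
    proof (rule force_compose[OF _ order_refl finU1])
      fix U2 E2
      assume 2: "U2 \<subseteq> U1" "E1 \<subseteq> E2" "card (U1 - U2) \<le> r1 * (q + 1)"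
        and ex: "dense_between E2 m (?V - Q1) Q1 \<and> expands_into E2 ?V ?Q (2 * m)"
      show "force q (60 * m + (n - 60 * m)) ?G U2 E2"
      proof (rule final)
        show "U2 \<subseteq> ?P" using 1 2 by blast
        have "card (?P - U2) \<le> card (?P - U1) + card (U1 - U2)" by (rule card_used_step[OF 2(1) finP 1(2)])
        then show "card (?P - U2) \<le> used" using 1(3) 2(3) by (simp add: used_def algebra_simps)
        show "?short E2"
        proof (intro allI impI)
          fix k assume "3 \<le> k \<and> k \<le> 60 * m"
          then have "has_cycle_within E1 (A \<union> B) k" using sh by blast
          then show "has_cycle_within E2 (A \<union> B) k"
            unfolding has_cycle_within_def using cycle_on_mono[OF _ 2(2)] by blast
        qed
      qed (use ex in auto)
    qed
  qed
  then show ?thesis by blast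
qed

theorem theorem1p4:
  "(\<forall>\<^sub>F n in sequentially. \<forall>q::nat. q > 0 \<and> real q \<ge> 1.1 * real n \<longrightarrow>
      client_can_maintain n q acyclic_graph) \<and>
   (\<exists>c::real. c > 0 \<and>
      (\<forall>\<^sub>F n in sequentially. \<forall>q::nat. q > 0 \<and> real q \<le> c * real n \<longrightarrow>
        waiter_can_force n q pancyclic))"
proof (intro conjI)
  show "\<forall>\<^sub>F n in sequentially. \<forall>q::nat. q > 0 \<and> real q \<ge> 1.1 * real n \<longrightarrow>
      client_can_maintain n q acyclic_graph"
    using client_keeps_acyclic by (intro always_eventually) blast
  have "waiter_can_force n q pancyclic" if q: "0 < q" "real q \<le> 1 / 100000000000 * real n" for n q
  proof -
    \<comment> \<open>A positive \<open>q\<close> with q <= n / 10^11 forces n >= 10^11, so the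
      requirement that n be large is met automatically, and rounding in the division is
      harmless.\<close>
    define m where "m = n div 200"
    have "real q * 100000000000 \<le> real n" using q(2) by simp
    then have "real (q * 100000000000) \<le> real n" by simp
    then have qn: "q * 100000000000 \<le> n" by (simp only: of_nat_le_iff)
    have nm: "200 * m \<le> n" "n < 200 * m + 200"
      unfolding m_def by (simp_all add: mult.commute div_times_less_eq_dividend dividend_less_times_div)
    have "q * 100000000 + 100000000 \<le> m" "n \<le> 400 * m" using qn nm q(1) by linarith+
    then have "(q + 1) * 100000000 \<le> m" "n \<le> 400 * m" by simp_all
    then obtain r where "force q r (\<lambda>U E. pancyclic ({..<n}, E)) (complete_edges n) {}"
      using force_pancyclic nm(1) by blast
    then show ?thesis by (rule force_imp_waiter_can_force) (rule pancyclic_mono)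
  qed
  then show "\<exists>c::real. c > 0 \<and>
      (\<forall>\<^sub>F n in sequentially. \<forall>q::nat. q > 0 \<and> real q \<le> c * real n \<longrightarrow>
        waiter_can_force n q pancyclic)"
    by (intro exI[of _ "1 / 100000000000"] conjI always_eventually) auto
qed

end
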